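(* Let $n\ge1$ and let $X_1,\dots,X_n$ be iid real random variables with arbitrary cdf $F$, and let $v_n=v_n(F)$ be the optimal best-choice probability. Then $$\underline v_n\le v_n\le \underline v_n+\delta_n,\qquad \delta_n=1-n\int_{-\infty}^{\infty}(1-F(x))^{n-1}\,\mathrm dF(x).$$ Hence, since $\underline v_n>\underline v$, the universal bound $v_n>\underline v$ holds for all $n$ and all $F$, and it is sharp (the constant $\underline v$ cannot be replaced by a larger one).
   Context: With $M_n=\min\{X_1,\dots,X_n\}$, the optimal best-choice probability is $v_n:=\sup_\tau\mathbb P(X_\tau=M_n)$, the supremum being over all stopping times $\tau$ adapted to the natural filtration of $X_1,\dots,X_n$. $\underline v_n$ denotes the value of $v_n$ when $X_1,\dots,X_n$ are iid uniform on $[0,1]$ (equivalently, iid with any continuous distribution), the so-called full-information game. The quantity $\delta_n$ is the probability of a tie for the minimum among $X_1,\dots,X_n$. It is a known fact (Samuels), which may be used, that $\underline v_n$ is strictly decreasing in $n$ with limit $\underline v:=\lim_{n\to\infty}\underline v_n=0.580164\cdots$, so that $\underline v_n>\underline v$ for all $n$. *)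

theory Defs
  imports "HOL-Probability.Probability"
begin

definition natural_filtration :: "'a measure \<Rightarrow> (nat \<Rightarrow> 'a \<Rightarrow> real) \<Rightarrow> nat \<Rightarrow> 'a measure" where
  "natural_filtration M X t =
     sigma (space M) {X i -` A \<inter> space M | i A. i \<in> {1..t} \<and> A \<in> sets borel}"

definition stopping_rules :: "'a measure \<Rightarrow> (nat \<Rightarrow> 'a \<Rightarrow> real) \<Rightarrow> nat \<Rightarrow> ('a \<Rightarrow> nat) set" where
  "stopping_rules M X n =
     {\<tau>. stopping_time (natural_filtration M X) \<tau> \<and> (\<forall>\<omega>\<in>space M. \<tau> \<omega> \<in> {1..n})}"

definition running_min :: "(nat \<Rightarrow> 'a \<Rightarrow> real) \<Rightarrow> nat \<Rightarrow> 'a \<Rightarrow> real" where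
  "running_min X n \<omega> = Min ((\<lambda>i. X i \<omega>) ` {1..n})"

definition win_prob :: "'a measure \<Rightarrow> (nat \<Rightarrow> 'a \<Rightarrow> real) \<Rightarrow> nat \<Rightarrow> ('a \<Rightarrow> nat) \<Rightarrow> real" where
  "win_prob M X n \<tau> = measure M {\<omega> \<in> space M. X (\<tau> \<omega>) \<omega> = running_min X n \<omega>}"

definition best_choice_value :: "'a measure \<Rightarrow> (nat \<Rightarrow> 'a \<Rightarrow> real) \<Rightarrow> nat \<Rightarrow> real" where
  "best_choice_value M X n = (SUP \<tau>\<in>stopping_rules M X n. win_prob M X n \<tau>)"

definition tie_prob :: "'a measure \<Rightarrow> (nat \<Rightarrow> 'a \<Rightarrow> real) \<Rightarrow> nat \<Rightarrow> real" where
  "tie_prob M X n = measure M {\<omega> \<in> space M. \<exists>i\<in>{1..n}. \<exists>j\<in>{1..n}. i \<noteq> j \<and>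
     X i \<omega> = running_min X n \<omega> \<and> X j \<omega> = running_min X n \<omega>}"

text \<open>The game on the coordinate space, with \<open>n\<close> independent observations of law \<open>\<nu>\<close>.\<close>

definition iid_value :: "real measure \<Rightarrow> nat \<Rightarrow> real" where
  "iid_value \<nu> n = best_choice_value (PiM {1..n} (\<lambda>_. \<nu>)) (\<lambda>i \<omega>. \<omega> i) n"

definition full_info_value :: "nat \<Rightarrow> real" where
  "full_info_value n = iid_value (uniform_measure lborel {0..1}) n"

text \<open>The limit exists because \<^const>\<open>full_info_value\<close> is decreasing on the positive integers
  (Samuels); its numerical value is \<open>0.580164...\<close>.\<close>

definition full_info_limit :: real where
  "full_info_limit = lim full_info_value"

end

theory Submission
  imports Defs
begin

text \<open>Both bounds come from couplings of the observations \<open>x\<close> with uniform observations \<open>u\<close> in which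
  \<open>u i \<le> u j\<close> implies \<open>x i \<le> x j\<close> outside the cases of ties. The sample
  space is without loss of generality the space of sequences (\<open>indep_vars_reduction\<close>), since a rule depends on
  the sample point only through the observations.

  Lower bound (\<open>full_info_value_le_iid_value\<close>). Randomizing each observation inside the jump of the cdf at
  that observation yields uniform variables (\<open>distr_distributional_transform\<close>), and a minimal uniform
  variable belongs to a minimal observation. A rule for the uniform game thereby becomes a randomized rule
  for the given law. By Fubini its winning probability is an average of winning probabilities of
  nonrandomized rules, hence at most the value of the game.

  Upper bound (\<open>iid_value_le_full_info_value_plus_tie\<close>). The quantile function maps uniform variables to
  variables of the given law and is monotone. A rule for the given law is thereby a rule for the uniform
  game; if it picks a smallest observation, but not the smallest uniform variable, then the smallest
  observation occurs twice. The probability of a tie is one minus the sum, over the positions, of the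
  probability of a strict minimum at that position (\<open>tie_prob_iid\<close>).

  Strict decrease of the full-information values. In the game with \<open>n + 1\<close> observations, tell the player
  in advance the value \<open>m\<close> of the largest observation and its position. After division by \<open>m\<close> the remaining \<open>n\<close>
  observations are independent and uniform, and the largest one never has to be chosen, so the informed
  player faces exactly the game with \<open>n\<close> observations (\<open>win_max_prob_le\<close>). Therefore the value does not
  increase. The decrease is strict for \<open>n \<ge> 2\<close> because the uninformed player cannot adapt the first
  decision to \<open>m\<close>: relative to \<open>m\<close>, very small first values must be accepted and values above \<open>3/4\<close> must be
  rejected, at a cost proportional to the probability of a wrong decision (\<open>first_decision_loss\<close>), while
  one and the same first value is relatively small for some \<open>m\<close> and relatively large for others
  (\<open>win_max_prob_less\<close>).

  The values thus converge to their infimum, which is never attained. The uniform law itself shows that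
  the constant is sharp.\<close>

section \<open>Rules, wins and ties\<close>

abbreviation (input) coord :: "nat \<Rightarrow> (nat \<Rightarrow> real) \<Rightarrow> real" where
  "coord \<equiv> \<lambda>i \<omega>. \<omega> i"

abbreviation (input) iid :: "real measure \<Rightarrow> nat \<Rightarrow> (nat \<Rightarrow> real) measure" where
  "iid \<nu> n \<equiv> PiM {1..n} (\<lambda>_. \<nu>)"

text \<open>Only for rules with values in \<open>{1..n}\<close> does comparison with all observations agree with equality to the
  running minimum.\<close>

definition win_event :: "'a measure \<Rightarrow> (nat \<Rightarrow> 'a \<Rightarrow> real) \<Rightarrow> nat \<Rightarrow> ('a \<Rightarrow> nat) \<Rightarrow> 'a set" where
  "win_event M X n \<tau> = {\<omega> \<in> space M. \<forall>j\<in>{1..n}. X (\<tau> \<omega>) \<omega> \<le> X j \<omega>}"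

definition tie_event :: "'a measure \<Rightarrow> (nat \<Rightarrow> 'a \<Rightarrow> real) \<Rightarrow> nat \<Rightarrow> 'a set" where
  "tie_event M X n = {\<omega> \<in> space M. \<exists>i\<in>{1..n}. \<exists>j\<in>{1..n}. i \<noteq> j \<and>
     (\<forall>l\<in>{1..n}. X i \<omega> \<le> X l \<omega> \<and> X j \<omega> \<le> X l \<omega>)}"

lemma eq_running_min_iff:
  assumes "i \<in> {1..n}"
  shows "X i \<omega> = running_min X n \<omega> \<longleftrightarrow> (\<forall>j\<in>{1..n}. X i \<omega> \<le> X j \<omega>)"
  using assms unfolding running_min_def by (subst eq_Min_iff) auto

lemma stopping_rules_range: "\<tau> \<in> stopping_rules M X n \<Longrightarrow> \<omega> \<in> space M \<Longrightarrow> \<tau> \<omega> \<in> {1..n}"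
  by (auto simp: stopping_rules_def)

lemma win_prob_eq:
  assumes "\<And>\<omega>. \<omega> \<in> space M \<Longrightarrow> \<tau> \<omega> \<in> {1..n}"
  shows "win_prob M X n \<tau> = measure M (win_event M X n \<tau>)"
proof -
  have "{\<omega> \<in> space M. X (\<tau> \<omega>) \<omega> = running_min X n \<omega>} = win_event M X n \<tau>"
    unfolding win_event_def by (intro Collect_cong conj_cong refl eq_running_min_iff assms)
  then show ?thesis by (simp add: win_prob_def)
qed

lemma tie_prob_eq: "tie_prob M X n = measure M (tie_event M X n)"
proof -
  have "X i \<omega> = running_min X n \<omega> \<and> X j \<omega> = running_min X n \<omega> \<longleftrightarrow> (\<forall>l\<in>{1..n}. X i \<omega> \<le> X l \<omega> \<and> X j \<omega> \<le> X l \<omega>)"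
    if "i \<in> {1..n}" "j \<in> {1..n}" for i j \<omega>
    unfolding eq_running_min_iff[OF that(1)] eq_running_min_iff[OF that(2)] by blast
  then have "{\<omega> \<in> space M. \<exists>i\<in>{1..n}. \<exists>j\<in>{1..n}. i \<noteq> j \<and>
      X i \<omega> = running_min X n \<omega> \<and> X j \<omega> = running_min X n \<omega>} = tie_event M X n"
    unfolding tie_event_def by blast
  then show ?thesis by (simp add: tie_prob_def)
qed

lemma space_natural_filtration [simp]: "space (natural_filtration M X t) = space M"
  unfolding natural_filtration_def by (rule space_measure_of) auto

lemma sets_natural_filtration:
  "sets (natural_filtration M X t) =
     sigma_sets (space M) {X i -` A \<inter> space M | i A. i \<in> {1..t} \<and> A \<in> sets borel}"
  unfolding natural_filtration_def by (rule sets_measure_of) auto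

lemma measurable_natural_filtration [measurable (raw)]:
  "i \<in> {1..t} \<Longrightarrow> X i \<in> borel_measurable (natural_filtration M X t)"
  by (rule measurableI) (auto simp: sets_natural_filtration intro!: sigma_sets.Basic)

text \<open>The natural filtration is the smallest one to which the observations are adapted, so adaptedness of a
  map into it can be tested on the observations.\<close>

lemma measurable_into_natural_filtration:
  assumes "\<phi> \<in> space N \<rightarrow> space M"
    and "\<And>i. i \<in> {1..t} \<Longrightarrow> (\<lambda>\<omega>. X i (\<phi> \<omega>)) \<in> borel_measurable N"
  shows "\<phi> \<in> N \<rightarrow>\<^sub>M natural_filtration M X t"
proof (rule measurable_sigma_sets[OF sets_natural_filtration _ assms(1)])
  fix B assume "B \<in> {X i -` A \<inter> space M | i A. i \<in> {1..t} \<and> A \<in> sets borel}"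
  then obtain i A where iA: "i \<in> {1..t}" "A \<in> sets borel" and B: "B = X i -` A \<inter> space M"
    by blast
  have "\<phi> -` B \<inter> space N = (\<lambda>\<omega>. X i (\<phi> \<omega>)) -` A \<inter> space N"
    using assms(1) B by auto
  then show "\<phi> -` B \<inter> space N \<in> sets N"
    using measurable_sets[OF assms(2)[OF iA(1)] iA(2)] by simp
qed auto

lemma sets_natural_filtration_mono:
  "s \<le> t \<Longrightarrow> sets (natural_filtration M X s) \<subseteq> sets (natural_filtration M X t)"
  unfolding sets_natural_filtration by (intro sigma_sets_mono') force

lemma sets_natural_filtration_subset:
  assumes "\<And>i. i \<in> {1..t} \<Longrightarrow> X i \<in> borel_measurable M"
  shows "sets (natural_filtration M X t) \<subseteq> sets M"
  unfolding sets_natural_filtration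
  using assms by (intro sets.sigma_sets_subset) (auto intro: measurable_sets)

lemma stopping_rules_measurable:
  assumes "\<tau> \<in> stopping_rules M X n" and "\<And>i. i \<in> {1..n} \<Longrightarrow> X i \<in> borel_measurable M"
  shows "\<tau> \<in> M \<rightarrow>\<^sub>M count_space UNIV"
proof -
  have "{\<omega> \<in> space M. \<tau> \<omega> \<le> t} \<in> sets M" for t
  proof (cases "t \<le> n")
    case True
    have "{\<omega> \<in> space M. \<tau> \<omega> \<le> t} \<in> sets (natural_filtration M X t)"
      using assms(1) by (auto simp: stopping_rules_def stopping_time_def pred_def)
    then show ?thesis
      using sets_natural_filtration_subset[of t X M] assms(2) True by auto
  next
    case False
    then have "{\<omega> \<in> space M. \<tau> \<omega> \<le> t} = space M"
      using stopping_rules_range[OF assms(1)] by fastforce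
    then show ?thesis by simp
  qed
  then have "\<tau> \<in> borel_measurable M"
    by (intro borel_measurableI_le)
  then show ?thesis
    by (simp add: measurable_cong_sets[OF refl sets_borel_eq_count_space])
qed

lemma win_event_measurable:
  assumes \<tau>: "\<tau> \<in> stopping_rules M X n" and [measurable]: "\<And>i. i \<in> {1..n} \<Longrightarrow> X i \<in> borel_measurable M"
  shows "win_event M X n \<tau> \<in> sets M"
proof -
  have [measurable]: "\<tau> \<in> M \<rightarrow>\<^sub>M count_space UNIV"
    by (rule stopping_rules_measurable[OF assms])
  have "win_event M X n \<tau> = (\<Union>i\<in>{1..n}. {\<omega> \<in> space M. \<tau> \<omega> = i \<and> (\<forall>j\<in>{1..n}. X i \<omega> \<le> X j \<omega>)})"
    using stopping_rules_range[OF \<tau>] by (auto simp: win_event_def)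
  also have "\<dots> \<in> sets M"
    by measurable
  finally show ?thesis .
qed

lemma tie_event_measurable:
  assumes [measurable]: "\<And>i. i \<in> {1..n} \<Longrightarrow> X i \<in> borel_measurable M"
  shows "tie_event M X n \<in> sets M"
  unfolding tie_event_def by measurable

lemma constant_rule: "i \<in> {1..n} \<Longrightarrow> (\<lambda>_. i) \<in> stopping_rules M X n"
  by (auto simp: stopping_rules_def stopping_time_def)

lemma win_prob_le_value:
  assumes "prob_space M" and "\<tau> \<in> stopping_rules M X n"
  shows "win_prob M X n \<tau> \<le> best_choice_value M X n"
  unfolding best_choice_value_def
proof (rule cSUP_upper[OF assms(2)])
  show "bdd_above (win_prob M X n ` stopping_rules M X n)"
    unfolding win_prob_def using prob_space.prob_le_1[OF assms(1)] by (auto intro!: bdd_aboveI[of _ 1])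
qed

lemma value_leI:
  assumes "1 \<le> n" and "\<And>\<tau>. \<tau> \<in> stopping_rules M X n \<Longrightarrow> win_prob M X n \<tau> \<le> c"
  shows "best_choice_value M X n \<le> c"
  unfolding best_choice_value_def
  using constant_rule[of 1 n M X] assms by (intro cSUP_least) auto

text \<open>Rules are transported along a map that translates the information available in one game into
  that of another. The clocks may run differently: what the new rule knows by time \<open>t\<close> comprises
  what the old rule knows by time \<open>g t\<close>.\<close>

lemma stopping_rules_transport:
  assumes \<sigma>: "\<sigma> \<in> stopping_rules M X N"
    and \<phi>: "\<phi> \<in> space M' \<rightarrow> space M"
    and adapted: "\<And>t i. 1 \<le> t \<Longrightarrow> t < n \<Longrightarrow> i \<in> {1..g t} \<Longrightarrow>
      (\<lambda>\<omega>. X i (\<phi> \<omega>)) \<in> borel_measurable (natural_filtration M' X' t)"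
    and range: "\<And>\<omega>. \<omega> \<in> space M' \<Longrightarrow> \<rho> \<omega> \<in> {1..n}"
    and le: "\<And>\<omega> t. \<omega> \<in> space M' \<Longrightarrow> 1 \<le> t \<Longrightarrow> t < n \<Longrightarrow> \<rho> \<omega> \<le> t \<longleftrightarrow> \<sigma> (\<phi> \<omega>) \<le> g t"
  shows "\<rho> \<in> stopping_rules M' X' n"
  unfolding stopping_rules_def
proof (intro CollectI conjI ballI range stopping_timeI)
  fix t
  consider "t = 0" | "1 \<le> t" "t < n" | "n \<le> t" by linarith
  then show "Measurable.pred (natural_filtration M' X' t) (\<lambda>\<omega>. \<rho> \<omega> \<le> t)"
  proof cases
    case 1
    then have "\<not> \<rho> \<omega> \<le> t" if "\<omega> \<in> space M'" for \<omega>
      using range[OF that] by auto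
    then show ?thesis
      by (subst measurable_cong[where g = "\<lambda>_. False"]) auto
  next
    case 2
    have [measurable]: "\<phi> \<in> natural_filtration M' X' t \<rightarrow>\<^sub>M natural_filtration M X (g t)"
      using \<phi> adapted 2 by (intro measurable_into_natural_filtration) auto
    have [measurable]: "Measurable.pred (natural_filtration M X (g t)) (\<lambda>\<omega>. \<sigma> \<omega> \<le> g t)"
      using \<sigma> by (auto simp: stopping_rules_def stopping_time_def)
    show ?thesis
      using le 2 by (subst measurable_cong[where g = "\<lambda>\<omega>. \<sigma> (\<phi> \<omega>) \<le> g t"]) auto
  next
    case 3
    then have "\<rho> \<omega> \<le> t" if "\<omega> \<in> space M'" for \<omega>
      using range[OF that] by auto
    then show ?thesis
      by (subst measurable_cong[where g = "\<lambda>_. True"]) auto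
  qed
qed

section \<open>Reduction to the coordinate game\<close>

text \<open>A Doob--Dynkin factorization for events: what is known at time \<open>t\<close> is a property of the observed values,
  and these can be read off from the image under \<open>\<phi>\<close>.\<close>

lemma natural_filtration_factor:
  assumes "\<phi> \<in> space M \<rightarrow> space N"
    and "\<And>i \<omega>. i \<in> {1..t} \<Longrightarrow> \<omega> \<in> space M \<Longrightarrow> Y i (\<phi> \<omega>) = X i \<omega>"
    and "A \<in> sets (natural_filtration M X t)"
  shows "\<exists>B \<in> sets (natural_filtration N Y t). A = \<phi> -` B \<inter> space M"
proof -
  let ?G = "{Y i -` A \<inter> space N | i A. i \<in> {1..t} \<and> A \<in> sets borel}"
  have "{\<phi> -` B \<inter> space M | B. B \<in> ?G} = {X i -` A \<inter> space M | i A. i \<in> {1..t} \<and> A \<in> sets borel}"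
    (is "?L = ?R")
  proof (intro equalityI subsetI)
    fix C assume "C \<in> ?L"
    then obtain i A where iA: "i \<in> {1..t}" "A \<in> sets borel" and C: "C = \<phi> -` (Y i -` A \<inter> space N) \<inter> space M"
      by blast
    have "C = X i -` A \<inter> space M"
      using assms(1) assms(2)[OF iA(1)] unfolding C by auto
    with iA show "C \<in> ?R" by (intro CollectI exI[of _ i] exI[of _ A] conjI)
  next
    fix C assume "C \<in> ?R"
    then obtain i A where iA: "i \<in> {1..t}" "A \<in> sets borel" and C: "C = X i -` A \<inter> space M"
      by blast
    have "C = \<phi> -` (Y i -` A \<inter> space N) \<inter> space M"
      using assms(1) assms(2)[OF iA(1)] unfolding C by auto
    with iA show "C \<in> ?L"
      by (intro CollectI exI[of _ "Y i -` A \<inter> space N"] exI[of _ i] exI[of _ A] conjI refl)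
  qed
  then have "sets (natural_filtration M X t) = {\<phi> -` B \<inter> space M | B. B \<in> sets (natural_filtration N Y t)}"
    using sigma_sets_vimage_commute[OF assms(1), of ?G] by (simp add: sets_natural_filtration)
  then show ?thesis using assms(3) by auto
qed

text \<open>The events that the rule has stopped by time \<open>t\<close> factor one by one. The factors need not be increasing
  in \<open>t\<close> outside the range of \<open>\<phi>\<close>; stopping at the first one that occurs repairs this.\<close>

lemma stopping_rules_factor:
  assumes \<phi>: "\<phi> \<in> space M \<rightarrow> space N"
    and Y: "\<And>i \<omega>. i \<in> {1..n} \<Longrightarrow> \<omega> \<in> space M \<Longrightarrow> Y i (\<phi> \<omega>) = X i \<omega>"
    and \<tau>: "\<tau> \<in> stopping_rules M X n" and "1 \<le> n"
  obtains \<rho> where "\<rho> \<in> stopping_rules N Y n" "\<And>\<omega>. \<omega> \<in> space M \<Longrightarrow> \<rho> (\<phi> \<omega>) = \<tau> \<omega>"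
proof -
  have "\<forall>t\<in>{1..n}. \<exists>B \<in> sets (natural_filtration N Y t). {\<omega> \<in> space M. \<tau> \<omega> \<le> t} = \<phi> -` B \<inter> space M"
  proof
    fix t assume t: "t \<in> {1..n}"
    have "{\<omega> \<in> space M. \<tau> \<omega> \<le> t} \<in> sets (natural_filtration M X t)"
      using \<tau> by (auto simp: stopping_rules_def stopping_time_def pred_def)
    moreover have "Y i (\<phi> \<omega>) = X i \<omega>" if "i \<in> {1..t}" "\<omega> \<in> space M" for i \<omega>
      using Y[of i] that t by auto
    ultimately show "\<exists>B \<in> sets (natural_filtration N Y t). {\<omega> \<in> space M. \<tau> \<omega> \<le> t} = \<phi> -` B \<inter> space M"
      using \<phi> by (intro natural_filtration_factor)
  qed
  then obtain B where B: "\<And>t. t \<in> {1..n} \<Longrightarrow> B t \<in> sets (natural_filtration N Y t)"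
    and eq: "\<And>t. t \<in> {1..n} \<Longrightarrow> {\<omega> \<in> space M. \<tau> \<omega> \<le> t} = \<phi> -` B t \<inter> space M"
    unfolding Bex_def bchoice_iff by blast
  \<comment> \<open>the alternative \<open>t = n\<close> makes \<open>\<rho>\<close> a total rule also off the range of \<open>\<phi>\<close>\<close>
  define \<rho> where "\<rho> x = (LEAST t. t = n \<or> (t \<in> {1..n} \<and> x \<in> B t))" for x
  have \<rho>_holds: "\<rho> x = n \<or> (\<rho> x \<in> {1..n} \<and> x \<in> B (\<rho> x))" for x
    unfolding \<rho>_def by (rule LeastI_ex) blast
  have \<rho>_le: "\<rho> x \<le> t \<longleftrightarrow> (\<exists>s\<in>{1..t}. x \<in> B s)" if "t < n" for t x
  proof
    assume "\<rho> x \<le> t"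
    then show "\<exists>s\<in>{1..t}. x \<in> B s" using \<rho>_holds[of x] that by auto
  next
    assume "\<exists>s\<in>{1..t}. x \<in> B s"
    then obtain s where "s \<in> {1..t}" "x \<in> B s" by blast
    moreover from this have "\<rho> x \<le> s" unfolding \<rho>_def using that by (intro Least_le) auto
    ultimately show "\<rho> x \<le> t" by auto
  qed
  have "\<rho> \<in> stopping_rules N Y n"
    unfolding stopping_rules_def
  proof (intro CollectI conjI ballI stopping_timeI)
    show "\<rho> x \<in> {1..n}" for x using \<rho>_holds[of x] \<open>1 \<le> n\<close> by auto
    fix t
    show "Measurable.pred (natural_filtration N Y t) (\<lambda>x. \<rho> x \<le> t)"
    proof (cases "t < n")
      case True
      have [measurable]: "B s \<in> sets (natural_filtration N Y t)" if "s \<in> {1..t}" for s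
        using B[of s] that True sets_natural_filtration_mono[of s t N Y] by auto
      show ?thesis unfolding \<rho>_le[OF True] by measurable
    next
      case False
      then have "\<rho> x \<le> t" for x using \<open>\<rho> x \<in> {1..n}\<close> by (meson atLeastAtMost_iff leI order_trans)
      then show ?thesis by simp
    qed
  qed
  moreover have "\<rho> (\<phi> \<omega>) = \<tau> \<omega>" if \<omega>: "\<omega> \<in> space M" for \<omega>
  proof -
    have *: "\<phi> \<omega> \<in> B t \<longleftrightarrow> \<tau> \<omega> \<le> t" if "t \<in> {1..n}" for t
      using eq[OF that] \<omega> by auto
    have "\<tau> \<omega> \<in> {1..n}" using stopping_rules_range[OF \<tau> \<omega>] .
    then show ?thesis
      unfolding \<rho>_def by (intro Least_equality) (auto simp: *)
  qed
  ultimately show thesis using that by blast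
qed

lemma measurable_coord_iid:
  "sets \<nu> = sets borel \<Longrightarrow> i \<in> {1..n} \<Longrightarrow> coord i \<in> borel_measurable (iid \<nu> n)"
  using measurable_component_singleton[of i "{1..n}" "\<lambda>_. \<nu>"] by (simp cong: measurable_cong_sets)

text \<open>Rules pull back along \<open>\<phi>\<close> by composition and push forward by factorization, and both operations preserve
  the winning probability.\<close>

lemma best_choice_value_distr:
  assumes M: "prob_space M" and N: "prob_space N"
    and \<phi>: "\<phi> \<in> M \<rightarrow>\<^sub>M N" and distr: "distr M N \<phi> = N"
    and eq: "\<And>i \<omega>. i \<in> {1..n} \<Longrightarrow> \<omega> \<in> space M \<Longrightarrow> Y i (\<phi> \<omega>) = X i \<omega>"
    and Y: "\<And>i. i \<in> {1..n} \<Longrightarrow> Y i \<in> borel_measurable N" and "1 \<le> n"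
  shows "best_choice_value M X n = best_choice_value N Y n"
    and "tie_prob M X n = tie_prob N Y n"
proof -
  have \<phi>_space: "\<phi> \<in> space M \<rightarrow> space N"
    using measurable_space[OF \<phi>] by auto
  have win: "win_prob M X n \<tau> = win_prob N Y n \<rho>"
    if \<tau>: "\<tau> \<in> stopping_rules M X n" and \<rho>: "\<rho> \<in> stopping_rules N Y n"
      and \<rho>\<tau>: "\<And>\<omega>. \<omega> \<in> space M \<Longrightarrow> \<rho> (\<phi> \<omega>) = \<tau> \<omega>" for \<tau> \<rho>
  proof -
    have "win_event M X n \<tau> = \<phi> -` win_event N Y n \<rho> \<inter> space M"
      using \<phi>_space eq stopping_rules_range[OF \<tau>] by (auto simp: win_event_def \<rho>\<tau>)
    then have "measure M (win_event M X n \<tau>) = measure (distr M N \<phi>) (win_event N Y n \<rho>)"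
      using measure_distr[OF \<phi> win_event_measurable[of \<rho> N Y n, OF \<rho> Y]] by simp
    then show ?thesis
      using stopping_rules_range[OF \<tau>] stopping_rules_range[OF \<rho>] by (simp add: win_prob_eq distr)
  qed
  show "best_choice_value M X n = best_choice_value N Y n"
  proof (intro antisym value_leI \<open>1 \<le> n\<close>)
    fix \<tau> assume \<tau>: "\<tau> \<in> stopping_rules M X n"
    obtain \<rho> where \<rho>: "\<rho> \<in> stopping_rules N Y n" "\<And>\<omega>. \<omega> \<in> space M \<Longrightarrow> \<rho> (\<phi> \<omega>) = \<tau> \<omega>"
      using stopping_rules_factor[of \<phi> M N n Y X \<tau>, OF \<phi>_space eq \<tau> \<open>1 \<le> n\<close>] by blast
    show "win_prob M X n \<tau> \<le> best_choice_value N Y n"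
      using win[OF \<tau> \<rho>(1)] \<rho>(2) win_prob_le_value[OF N \<rho>(1)] by simp
  next
    fix \<rho> assume \<rho>: "\<rho> \<in> stopping_rules N Y n"
    have "(\<lambda>\<omega>. \<rho> (\<phi> \<omega>)) \<in> stopping_rules M X n"
    proof (rule stopping_rules_transport[OF \<rho> \<phi>_space, where g = "\<lambda>t. t"])
      fix t i assume "1 \<le> t" "t < n" "i \<in> {1..t}"
      then show "(\<lambda>\<omega>. Y i (\<phi> \<omega>)) \<in> borel_measurable (natural_filtration M X t)"
        by (subst measurable_cong[where g = "X i"]) (auto simp: eq intro!: measurable_natural_filtration)
    qed (use \<phi>_space stopping_rules_range[OF \<rho>] in auto)
    from win[OF this \<rho>] win_prob_le_value[OF M this]
    show "win_prob N Y n \<rho> \<le> best_choice_value M X n" by simp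
  qed
  have "(\<exists>i\<in>{1..n}. \<exists>j\<in>{1..n}. i \<noteq> j \<and> (\<forall>l\<in>{1..n}. Y i (\<phi> \<omega>) \<le> Y l (\<phi> \<omega>) \<and> Y j (\<phi> \<omega>) \<le> Y l (\<phi> \<omega>))) \<longleftrightarrow>
      (\<exists>i\<in>{1..n}. \<exists>j\<in>{1..n}. i \<noteq> j \<and> (\<forall>l\<in>{1..n}. X i \<omega> \<le> X l \<omega> \<and> X j \<omega> \<le> X l \<omega>))"
    if "\<omega> \<in> space M" for \<omega>
    by (intro bex_cong ball_cong conj_cong refl) (simp_all only: eq that)
  then have "tie_event M X n = \<phi> -` tie_event N Y n \<inter> space M"
    unfolding tie_event_def using \<phi>_space by blast
  then have "measure M (tie_event M X n) = measure (distr M N \<phi>) (tie_event N Y n)"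
    using measure_distr[OF \<phi> tie_event_measurable[of n Y N, OF Y]] by simp
  then show "tie_prob M X n = tie_prob N Y n"
    by (simp add: tie_prob_eq distr)
qed

lemma indep_vars_reduction:
  assumes M: "prob_space M" and "1 \<le> n"
    and indep: "prob_space.indep_vars M (\<lambda>_. borel) X {1..n}"
    and law: "\<And>i. i \<in> {1..n} \<Longrightarrow> distr M borel (X i) = \<nu>"
  shows "best_choice_value M X n = iid_value \<nu> n"
    and "tie_prob M X n = tie_prob (iid \<nu> n) coord n"
proof -
  interpret prob_space M by fact
  have X [measurable]: "X i \<in> borel_measurable M" if "i \<in> {1..n}" for i
    using indep that by (auto simp: indep_vars_def)
  have \<nu>: "sets \<nu> = sets borel" "prob_space \<nu>"
    using law[of 1] \<open>1 \<le> n\<close> X[of 1] by (auto intro: prob_space_distr)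
  then have sets: "sets (iid \<nu> n) = sets (iid borel n)"
    by (intro sets_PiM_cong) auto
  let ?\<phi> = "\<lambda>\<omega>. \<lambda>i\<in>{1..n}. X i \<omega>"
  have \<phi>: "?\<phi> \<in> M \<rightarrow>\<^sub>M iid \<nu> n"
    unfolding measurable_cong_sets[OF refl sets] by measurable
  have "distr M (iid \<nu> n) ?\<phi> = distr M (iid borel n) ?\<phi>"
    by (intro distr_cong sets) auto
  also have "\<dots> = PiM {1..n} (\<lambda>i. distr M borel (X i))"
    using indep_vars_iff_distr_eq_PiM'[where I = "{1..n}" and M' = "\<lambda>_. borel" and X = X] indep X \<open>1 \<le> n\<close> by auto
  also have "\<dots> = iid \<nu> n"
    using law by (intro PiM_cong) auto
  finally have distr: "distr M (iid \<nu> n) ?\<phi> = iid \<nu> n" .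
  have "prob_space (iid \<nu> n)"
    using \<nu> by (intro prob_space_PiM) auto
  from best_choice_value_distr[OF M this \<phi> distr, of n coord X] measurable_coord_iid \<nu>(1) \<open>1 \<le> n\<close>
  show "best_choice_value M X n = iid_value \<nu> n"
    and "tie_prob M X n = tie_prob (iid \<nu> n) coord n"
    by (auto simp: iid_value_def)
qed

section \<open>Independent observations\<close>

lemma measure_pair_measure:
  assumes "prob_space A" "prob_space B" and E: "E \<in> sets (A \<Otimes>\<^sub>M B)"
  shows "integrable A (\<lambda>x. measure B (Pair x -` E))"
    and "measure (A \<Otimes>\<^sub>M B) E = (LINT x|A. measure B (Pair x -` E))"
proof -
  interpret A: prob_space A by fact
  interpret B: prob_space B by fact
  interpret AB: pair_prob_space A B ..
  have [measurable]: "(\<lambda>x. measure B (Pair x -` E)) \<in> borel_measurable A"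
    unfolding measure_def using B.measurable_emeasure_Pair[OF E] by measurable
  show int: "integrable A (\<lambda>x. measure B (Pair x -` E))"
    by (rule A.integrable_const_bound[where B = 1]) auto
  have "emeasure (A \<Otimes>\<^sub>M B) E = (\<integral>\<^sup>+x. ennreal (measure B (Pair x -` E)) \<partial>A)"
    by (simp add: B.emeasure_pair_measure_alt[OF E] B.emeasure_eq_measure)
  also have "\<dots> = ennreal (LINT x|A. measure B (Pair x -` E))"
    by (rule nn_integral_eq_integral[OF int]) simp
  finally show "measure (A \<Otimes>\<^sub>M B) E = (LINT x|A. measure B (Pair x -` E))"
    by (simp add: measure_def)
qed

lemma iid_prob_space: "real_distribution \<nu> \<Longrightarrow> prob_space (iid \<nu> n)"
  by (intro prob_space_PiM) (simp add: real_distribution.axioms)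

lemma real_distribution_space: "real_distribution \<nu> \<Longrightarrow> space \<nu> = UNIV"
  by (rule real_distribution.space_eq_univ)

lemma measure_iid_box:
  assumes "real_distribution \<nu>" and A: "\<And>i. i \<in> {1..n} \<Longrightarrow> A i \<in> sets borel"
  shows "measure (iid \<nu> n) (PiE {1..n} A) = (\<Prod>i\<in>{1..n}. measure \<nu> (A i))"
proof -
  interpret real_distribution \<nu> by fact
  interpret P: finite_product_prob_space "\<lambda>_::nat. \<nu>" "{1..n}"
    by standard simp
  show ?thesis using A by (intro P.prob_times) auto
qed

lemma AE_iid_coordinates:
  assumes "real_distribution \<nu>" and "AE x in \<nu>. P x"
  shows "AE \<omega> in iid \<nu> n. \<forall>i\<in>{1..n}. P (\<omega> i)"
  using assms by (intro AE_finite_allI AE_PiM_component[where M = "\<lambda>_. \<nu>"])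
    (simp_all add: real_distribution.axioms)

definition insert_at :: "nat \<Rightarrow> nat \<Rightarrow> real \<Rightarrow> (nat \<Rightarrow> real) \<Rightarrow> nat \<Rightarrow> real" where
  "insert_at n k m y = (\<lambda>i\<in>{1..Suc n}. if i < k then y i else if i = k then m else y (i - 1))"

text \<open>The position to which an entry moves when a new one is inserted at \<open>k\<close>.\<close>

definition skip :: "nat \<Rightarrow> nat \<Rightarrow> nat" where
  "skip k i = (if i < k then i else Suc i)"

lemma bij_betw_skip: "k \<in> {1..Suc n} \<Longrightarrow> bij_betw (skip k) {1..n} ({1..Suc n} - {k})"
  by (rule bij_betw_byWitness[where f' = "\<lambda>i. if i < k then i else i - 1"]) (auto simp: skip_def)

lemma insert_at_skip: "k \<in> {1..Suc n} \<Longrightarrow> i \<in> {1..n} \<Longrightarrow> insert_at n k m y (skip k i) = y i"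
  by (auto simp: insert_at_def skip_def)

lemma insert_at_same: "k \<in> {1..Suc n} \<Longrightarrow> insert_at n k m y k = m"
  by (auto simp: insert_at_def)

lemma insert_at_ball_others:
  assumes "k \<in> {1..Suc n}"
  shows "(\<forall>i\<in>{1..Suc n} - {k}. P (insert_at n k m y i)) \<longleftrightarrow> (\<forall>i\<in>{1..n}. P (y i))"
  using insert_at_skip[OF assms] bij_betw_skip[OF assms, THEN bij_betw_imp_surj_on, symmetric]
  by (simp del: atLeastAtMost_iff)

lemma ball_insert_at:
  assumes "k \<in> {1..Suc n}"
  shows "(\<forall>i\<in>{1..Suc n}. P (insert_at n k m y i)) \<longleftrightarrow> P m \<and> (\<forall>i\<in>{1..n}. P (y i))"
proof -
  have split: "{1..Suc n} = insert k ({1..Suc n} - {k})" using assms by auto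
  show ?thesis
    by (subst split) (simp only: Set.ball_simps insert_at_same[OF assms] insert_at_ball_others[OF assms, of P m y])
qed

lemma measurable_insert_at:
  assumes "real_distribution \<nu>" and k: "k \<in> {1..Suc n}"
  shows "(\<lambda>(m, y). insert_at n k m y) \<in> \<nu> \<Otimes>\<^sub>M iid \<nu> n \<rightarrow>\<^sub>M iid \<nu> (Suc n)"
proof -
  have snd: "(\<lambda>p. snd p j) \<in> \<nu> \<Otimes>\<^sub>M iid \<nu> n \<rightarrow>\<^sub>M \<nu>" if "j \<in> {1..n}" for j
    by (rule measurable_compose[OF measurable_snd measurable_component_singleton[OF that]])
  have "(\<lambda>p. if i < k then snd p i else if i = k then fst p else snd p (i - 1)) \<in> \<nu> \<Otimes>\<^sub>M iid \<nu> n \<rightarrow>\<^sub>M \<nu>"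
    if "i \<in> {1..Suc n}" for i
  proof (cases i k rule: linorder_cases)
    case less
    then have "i \<in> {1..n}" using that k by auto
    then show ?thesis using snd[of i] less by simp
  next
    case equal
    then show ?thesis by simp
  next
    case greater
    then have "i - 1 \<in> {1..n}" using that k by auto
    from snd[OF this] show ?thesis using greater by simp
  qed
  then show ?thesis
    unfolding insert_at_def case_prod_beta by (intro measurable_restrict)
qed

text \<open>Exchangeability: one coordinate, wherever it stands, can be sampled before the others.\<close>

lemma distr_insert_at:
  assumes \<nu>: "real_distribution \<nu>" and k: "k \<in> {1..Suc n}"
  shows "distr (\<nu> \<Otimes>\<^sub>M iid \<nu> n) (iid \<nu> (Suc n)) (\<lambda>(m, y). insert_at n k m y) = iid \<nu> (Suc n)" (is "?D = _")
proof -
  interpret real_distribution \<nu> by fact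
  interpret P: finite_product_prob_space "\<lambda>_::nat. \<nu>" "{1..n}"
    by standard simp
  show ?thesis
  proof (rule P.PiM_eqI)
    fix A assume A: "\<And>i. i \<in> {1..Suc n} \<Longrightarrow> A i \<in> sets \<nu>"
    let ?C = "PiE {1..n} (\<lambda>i. A (skip k i))"
    note bij = bij_betw_skip[OF k]
    have A': "A (skip k i) \<in> sets \<nu>" if "i \<in> {1..n}" for i
      using bij_betwE[OF bij] that A by auto
    have split: "{1..Suc n} = insert k ({1..Suc n} - {k})" using k by auto
    have "(\<forall>i\<in>{1..Suc n}. insert_at n k m y i \<in> A i) \<longleftrightarrow> m \<in> A k \<and> (\<forall>i\<in>{1..n}. y i \<in> A (skip k i))" for m y
    proof -
      have "(\<forall>i\<in>{1..Suc n} - {k}. insert_at n k m y i \<in> A i) \<longleftrightarrow> (\<forall>i\<in>{1..n}. y i \<in> A (skip k i))"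
        using insert_at_skip[OF k] bij[THEN bij_betw_imp_surj_on, symmetric] by (simp del: atLeastAtMost_iff)
      then show ?thesis
        by (subst split) (simp only: Set.ball_simps insert_at_same[OF k])
    qed
    moreover have "insert_at n k m y \<in> extensional {1..Suc n}" for m y
      by (simp add: insert_at_def)
    ultimately have pre: "(\<lambda>(m, y). insert_at n k m y) -` PiE {1..Suc n} A \<inter> space (\<nu> \<Otimes>\<^sub>M iid \<nu> n) = A k \<times> ?C"
      by (auto simp: space_pair_measure space_PiM PiE_iff simp del: atLeastAtMost_iff)
    have "?D (PiE {1..Suc n} A) = (\<nu> \<Otimes>\<^sub>M iid \<nu> n) (A k \<times> ?C)"
      using A by (subst emeasure_distr[OF measurable_insert_at[OF \<nu> k]]) (simp_all only: pre sets_PiM_I_finite finite_atLeastAtMost)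
    also have "\<dots> = \<nu> (A k) * iid \<nu> n ?C"
      using A k A' by (intro P.emeasure_pair_measure_Times sets_PiM_I_finite) auto
    also have "iid \<nu> n ?C = (\<Prod>i\<in>{1..n}. \<nu> (A (skip k i)))"
      using A' by (intro P.emeasure_PiM) auto
    also have "\<dots> = (\<Prod>i\<in>{1..Suc n} - {k}. \<nu> (A i))"
      by (rule prod.reindex_bij_betw[OF bij])
    also have "\<nu> (A k) * \<dots> = (\<Prod>i\<in>{1..Suc n}. \<nu> (A i))"
      using k by (intro prod.remove[symmetric]) auto
    finally show "?D (PiE {1..Suc n} A) = (\<Prod>i\<in>{1..Suc n}. \<nu> (A i))" .
  qed simp_all
qed

text \<open>Conditioning on the value of the \<open>k\<close>-th coordinate.\<close>

lemma measure_iid_Suc: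
  assumes \<nu>: "real_distribution \<nu>" and k: "k \<in> {1..Suc n}" and E: "E \<in> sets (iid \<nu> (Suc n))"
  shows "integrable \<nu> (\<lambda>m. measure (iid \<nu> n) {y \<in> space (iid \<nu> n). insert_at n k m y \<in> E})"
    and "measure (iid \<nu> (Suc n)) E =
      (LINT m|\<nu>. measure (iid \<nu> n) {y \<in> space (iid \<nu> n). insert_at n k m y \<in> E})"
proof -
  let ?E = "(\<lambda>(m, y). insert_at n k m y) -` E \<inter> space (\<nu> \<Otimes>\<^sub>M iid \<nu> n)"
  have slice: "Pair m -` ?E = {y \<in> space (iid \<nu> n). insert_at n k m y \<in> E}" for m
    by (auto simp: space_pair_measure real_distribution_space[OF \<nu>])
  have E': "?E \<in> sets (\<nu> \<Otimes>\<^sub>M iid \<nu> n)"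
    by (rule measurable_sets[OF measurable_insert_at[OF \<nu> k] E])
  note pair = measure_pair_measure[OF real_distribution.axioms(1)[OF \<nu>] iid_prob_space[OF \<nu>] E', unfolded slice]
  show "integrable \<nu> (\<lambda>m. measure (iid \<nu> n) {y \<in> space (iid \<nu> n). insert_at n k m y \<in> E})"
    by (rule pair(1))
  have "measure (iid \<nu> (Suc n)) E = measure (\<nu> \<Otimes>\<^sub>M iid \<nu> n) ?E"
    using measure_distr[OF measurable_insert_at[OF \<nu> k] E] by (simp only: distr_insert_at[OF \<nu> k])
  then show "measure (iid \<nu> (Suc n)) E =
      (LINT m|\<nu>. measure (iid \<nu> n) {y \<in> space (iid \<nu> n). insert_at n k m y \<in> E})"
    by (simp only: pair(2))
qed

section \<open>The probability of a tie\<close>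

text \<open>There is no tie exactly if some observation is strictly smaller than all others. These events are disjoint,
  and each has the probability given by the integral, by conditioning on the observation in question.\<close>

lemma tie_prob_iid:
  assumes \<nu>: "real_distribution \<nu>" and "1 \<le> n"
  shows "tie_prob (iid \<nu> n) coord n = 1 - real n * (LINT x|\<nu>. (1 - cdf \<nu> x) ^ (n - 1))"
proof -
  interpret real_distribution \<nu> by fact
  interpret P: prob_space "iid \<nu> n" by (rule iid_prob_space[OF \<nu>])
  obtain k where n: "n = Suc k" using \<open>1 \<le> n\<close> by (cases n) auto
  have [measurable]: "coord i \<in> borel_measurable (iid \<nu> n)" if "i \<in> {1..n}" for i
    using that by (intro measurable_coord_iid) auto
  define U where "U i = {\<omega> \<in> space (iid \<nu> n). \<forall>j\<in>{1..n} - {i}. \<omega> i < \<omega> j}" for i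
  have U_sets: "U i \<in> sets (iid \<nu> n)" if "i \<in> {1..n}" for i
    unfolding U_def using that by measurable
  have "U i \<inter> U j = {}" if "i \<in> {1..n}" "j \<in> {1..n}" "i \<noteq> j" for i j
  proof (rule equals0I)
    fix \<omega> assume "\<omega> \<in> U i \<inter> U j"
    then have "\<omega> i < \<omega> j" "\<omega> j < \<omega> i"
      using that unfolding U_def by blast+
    then show False by simp
  qed
  then have "disjoint_family_on U {1..n}"
    unfolding disjoint_family_on_def by blast
  have measure_U: "measure (iid \<nu> n) (U i) = (LINT x|\<nu>. (1 - cdf \<nu> x) ^ (n - 1))" if i: "i \<in> {1..n}" for i
  proof -
    have i': "i \<in> {1..Suc k}" using i n by simp
    have "{y \<in> space (iid \<nu> k). insert_at k i m y \<in> U i} = PiE {1..k} (\<lambda>_. {m<..})" for m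
    proof -
      have "insert_at k i m y \<in> space (iid \<nu> n)" for y
        by (simp add: space_PiM insert_at_def n)
      then have "insert_at k i m y \<in> U i \<longleftrightarrow> (\<forall>j\<in>{1..k}. m < y j)" for y
        using insert_at_ball_others[OF i', of "\<lambda>x. m < x" m y] insert_at_same[OF i', of m y]
        by (simp add: U_def n)
      then show ?thesis
        by (auto simp: space_PiM PiE_def simp del: atLeastAtMost_iff)
    qed
    moreover have "measure (iid \<nu> k) (PiE {1..k} (\<lambda>_. {m<..})) = (1 - cdf \<nu> m) ^ (n - 1)" for m
    proof -
      have "prob (UNIV - {..m}) = 1 - cdf \<nu> m"
        unfolding cdf_def using prob_compl[of "{..m}"] by simp
      moreover have "UNIV - {..m} = {m<..}" by auto
      ultimately show ?thesis
        using measure_iid_box[OF \<nu>, of k "\<lambda>_. {m<..}"] by (simp add: n)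
    qed
    ultimately show ?thesis
      using measure_iid_Suc(2)[OF \<nu> i', of "U i"] U_sets[OF i] by (simp add: n)
  qed
  have "tie_event (iid \<nu> n) coord n = space (iid \<nu> n) - (\<Union>i\<in>{1..n}. U i)"
  proof (intro equalityI subsetI)
    fix \<omega> assume "\<omega> \<in> tie_event (iid \<nu> n) coord n"
    then obtain i j where ij: "\<omega> \<in> space (iid \<nu> n)" "i \<in> {1..n}" "j \<in> {1..n}" "i \<noteq> j"
      and min: "\<And>l. l \<in> {1..n} \<Longrightarrow> \<omega> i \<le> \<omega> l" "\<And>l. l \<in> {1..n} \<Longrightarrow> \<omega> j \<le> \<omega> l"
      unfolding tie_event_def by blast
    have "\<omega> \<notin> U l" if l: "l \<in> {1..n}" for l
    proof
      assume "\<omega> \<in> U l"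
      then have "\<And>j. j \<in> {1..n} \<Longrightarrow> j \<noteq> l \<Longrightarrow> \<omega> l < \<omega> j"
        unfolding U_def by blast
      from this[of i] this[of j] min(1)[OF l] min(2)[OF l] ij show False
        by (cases "l = i") auto
    qed
    with ij show "\<omega> \<in> space (iid \<nu> n) - (\<Union>i\<in>{1..n}. U i)" by blast
  next
    fix \<omega> assume \<omega>: "\<omega> \<in> space (iid \<nu> n) - (\<Union>i\<in>{1..n}. U i)"
    obtain i where i: "i \<in> {1..n}" "\<And>l. l \<in> {1..n} \<Longrightarrow> \<omega> i \<le> \<omega> l"
      using ex_min_if_finite[of "\<omega> ` {1..n}"] \<open>1 \<le> n\<close> by (auto simp: not_less)
    have "\<not> (\<forall>j\<in>{1..n} - {i}. \<omega> i < \<omega> j)"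
      using i(1) \<omega> unfolding U_def by blast
    then obtain j where j: "j \<in> {1..n}" "i \<noteq> j" "\<omega> j \<le> \<omega> i"
      unfolding not_less[symmetric] by blast
    then have "\<And>l. l \<in> {1..n} \<Longrightarrow> \<omega> j \<le> \<omega> l"
      using i(2) by (blast intro: order_trans)
    then show "\<omega> \<in> tie_event (iid \<nu> n) coord n"
      using \<omega> i j unfolding tie_event_def by blast
  qed
  then have "tie_prob (iid \<nu> n) coord n = 1 - P.prob (\<Union>i\<in>{1..n}. U i)"
    using U_sets by (simp only: tie_prob_eq, subst P.prob_compl) auto
  also have "P.prob (\<Union>i\<in>{1..n}. U i) = (\<Sum>i\<in>{1..n}. P.prob (U i))"
    using U_sets \<open>disjoint_family_on U {1..n}\<close> by (intro P.finite_measure_finite_Union) auto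
  also have "\<dots> = real n * (LINT x|\<nu>. (1 - cdf \<nu> x) ^ (n - 1))"
    using measure_U by simp
  finally show ?thesis .
qed

section \<open>The uniform distribution\<close>

abbreviation (input) unif :: "real measure" where
  "unif \<equiv> uniform_measure lborel {0..1}"

lemma real_distribution_unif: "real_distribution unif"
proof -
  interpret prob_space unif
    by (rule prob_space_uniform_measure) auto
  show ?thesis by unfold_locales auto
qed

lemma measure_unif: "A \<in> sets borel \<Longrightarrow> measure unif A = measure lborel ({0..1} \<inter> A)"
  by (subst measure_uniform_measure) auto

lemma measure_unif_subset:
  "A \<in> sets borel \<Longrightarrow> A \<subseteq> {0..1} \<Longrightarrow> measure unif A = measure lborel A"
  by (simp add: measure_unif Int_absorb1)

lemma cdf_unif: "0 \<le> u \<Longrightarrow> u \<le> 1 \<Longrightarrow> cdf unif u = u"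
proof -
  assume u: "0 \<le> u" "u \<le> 1"
  then have "{0..1} \<inter> {..u} = {0..u}" by auto
  with u show ?thesis by (simp add: cdf_def measure_unif)
qed

lemma AE_unif: "AE x in unif. 0 < x \<and> x < 1"
proof (rule AE_uniform_measureI)
  show "AE x in lborel. x \<in> {0..1::real} \<longrightarrow> 0 < x \<and> x < 1"
    using AE_lborel_singleton[of "0::real"] AE_lborel_singleton[of "1::real"] by eventually_elim auto
qed simp

lemma integral_unif:
  fixes f :: "real \<Rightarrow> real"
  assumes "f \<in> borel_measurable borel"
  shows "(LINT x|unif. f x) = (LINT x|lborel. f x * indicator {0..1} x)"
proof -
  have "unif = density lborel (\<lambda>x. ennreal (indicator {0..1} x))"
    by (simp add: uniform_measure_def ennreal_indicator divide_ennreal_def)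
  then show ?thesis
    using assms by (simp add: integral_density mult.commute)
qed

lemma integral_unif_power: "(LINT x|unif. x ^ k) = 1 / real (Suc k)"
  by (subst integral_unif) (simp_all add: integral_power)

lemma tie_prob_unif:
  assumes "1 \<le> n"
  shows "tie_prob (iid unif n) coord n = 0"
proof -
  interpret real_distribution unif by (rule real_distribution_unif)
  obtain k where n: "n = Suc k" using assms by (cases n) auto
  have "(LINT x|unif. (1 - cdf unif x) ^ k) = (LINT x|unif. (1 - x) ^ k)"
  proof (rule integral_cong_AE)
    have [measurable]: "cdf unif \<in> borel_measurable borel"
      by (intro borel_measurable_mono monoI cdf_nondecreasing)
    show "(\<lambda>x. (1 - cdf unif x) ^ k) \<in> borel_measurable unif"
      by measurable
    show "AE x in unif. (1 - cdf unif x) ^ k = (1 - x) ^ k"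
      using AE_unif by eventually_elim (simp add: cdf_unif)
  qed simp
  also have "\<dots> = (LINT x|lborel. (1 - x) ^ k * indicator {0..1} x)"
    by (rule integral_unif) simp
  also have "\<dots> = (LINT x|lborel. x ^ k * indicator {0..1} x)"
    by (subst lborel_integral_real_affine[where c = "-1" and t = 1])
      (auto intro!: Bochner_Integration.integral_cong split: split_indicator)
  also have "\<dots> = (LINT x|unif. x ^ k)"
    by (rule integral_unif[symmetric]) simp
  finally show ?thesis
    using tie_prob_iid[OF real_distribution_unif assms] by (simp add: n integral_unif_power)
qed

text \<open>One-sided bounds suffice, since \<open>measure D {..u} \<le> measure D {..<w}\<close> whenever \<open>u < w\<close>. The
  criterion thereby leaves aside whether \<open>D\<close> has mass at \<open>u\<close>.\<close>

lemma unif_eqI: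
  assumes D: "real_distribution D"
    and le: "\<And>u. 0 < u \<Longrightarrow> u < 1 \<Longrightarrow> measure D {..<u} \<le> u"
    and ge: "\<And>u. 0 < u \<Longrightarrow> u < 1 \<Longrightarrow> u \<le> measure D {..u}"
  shows "D = unif"
proof (rule cdf_unique[OF D real_distribution_unif])
  interpret D: real_distribution D by fact
  interpret U: real_distribution unif by (rule real_distribution_unif)
  have lt: "D.prob {..x} \<le> y" if "x < y" "0 < y" "y < 1" for x y
  proof -
    have "D.prob {..x} \<le> D.prob {..<y}"
      using that by (intro D.finite_measure_mono) auto
    then show ?thesis using le that by fastforce
  qed
  have "cdf D x = cdf unif x" for x
  proof -
    consider "x \<le> 0" | "0 < x" "x < 1" | "1 \<le> x" by linarith
    then show ?thesis
    proof cases
      case 1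
      have "D.prob {..x} \<le> 0"
      proof (rule field_le_epsilon)
        fix e :: real assume "0 < e"
        have "D.prob {..x} \<le> min e (1/2)"
          using 1 \<open>0 < e\<close> by (intro lt) auto
        then show "D.prob {..x} \<le> 0 + e" by simp
      qed
      moreover have "cdf unif x \<le> cdf unif 0"
        using 1 by (rule U.cdf_nondecreasing)
      moreover have "cdf unif 0 = 0" by (simp add: cdf_unif)
      ultimately show ?thesis
        using U.cdf_nonneg[of x] D.cdf_nonneg[of x] unfolding cdf_def by linarith
    next
      case 2
      have "D.prob {..x} \<le> x"
      proof (rule dense_ge_bounded)
        show "x < 1" by fact
        show "D.prob {..x} \<le> w" if "x < w" "w < 1" for w
          using lt[of x w] that 2 by simp
      qed
      then show ?thesis
        using ge[OF 2] 2 by (simp add: cdf_unif cdf_def)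
    next
      case 3
      have "1 \<le> D.prob {..x}"
      proof (rule dense_le_bounded)
        show "0 < (1::real)" by simp
        fix w :: real assume "0 < w" "w < 1"
        then have "w \<le> D.prob {..w}" by (rule ge)
        also have "\<dots> \<le> D.prob {..x}"
          using 3 \<open>w < 1\<close> by (intro D.finite_measure_mono) auto
        finally show "w \<le> D.prob {..x}" .
      qed
      moreover have "cdf unif 1 \<le> cdf unif x"
        using 3 by (rule U.cdf_nondecreasing)
      moreover have "cdf unif 1 = 1" by (simp add: cdf_unif)
      ultimately show ?thesis
        using U.cdf_bounded_prob[of x] D.cdf_bounded_prob[of x] unfolding cdf_def by linarith
    qed
  qed
  then show "cdf D = cdf unif" by blast
qed

section \<open>Ties do not hurt\<close>

text \<open>The point that divides the jump of the cdf at \<open>x\<close> in the ratio \<open>v : 1 - v\<close>.\<close>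

definition distributional_transform :: "real measure \<Rightarrow> real \<Rightarrow> real \<Rightarrow> real" where
  "distributional_transform \<nu> v x = (1 - v) * measure \<nu> {..<x} + v * measure \<nu> {..x}"

lemma measure_Times:
  assumes "prob_space A" "prob_space B" "X \<in> sets A" "Y \<in> sets B"
  shows "measure (A \<Otimes>\<^sub>M B) (X \<times> Y) = measure A X * measure B Y"
proof -
  interpret B: prob_space B by fact
  show ?thesis
    using assms by (simp add: measure_def B.emeasure_pair_measure_Times enn2real_mult)
qed

context real_distribution
begin

lemma prob_lessThan_mono: "x \<le> y \<Longrightarrow> prob {..<x} \<le> prob {..<y}"
  by (intro finite_measure_mono) auto

lemma prob_atMost_le_lessThan: "x < y \<Longrightarrow> prob {..x} \<le> prob {..<y}"
  by (intro finite_measure_mono) auto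

lemma prob_atMost_eq: "prob {..x} = prob {..<x} + prob {x}"
proof -
  have "prob ({..<x} \<union> {x}) = prob {..<x} + prob {x}"
    by (rule finite_measure_Union) auto
  also have "{..<x} \<union> {x} = {..x}" by auto
  finally show ?thesis .
qed

lemma distributional_transform_bounds:
  assumes "0 \<le> v" "v \<le> 1"
  shows "prob {..<x} \<le> distributional_transform M v x" "distributional_transform M v x \<le> prob {..x}"
proof -
  have eq: "distributional_transform M v x = prob {..<x} + v * prob {x}"
    by (simp add: distributional_transform_def prob_atMost_eq algebra_simps)
  show "prob {..<x} \<le> distributional_transform M v x"
    using assms by (simp add: eq)
  have "v * prob {x} \<le> prob {x}"
    using assms by (intro mult_left_le_one_le) auto
  then show "distributional_transform M v x \<le> prob {..x}"
    by (simp add: eq prob_atMost_eq)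
qed

lemma measurable_distributional_transform [measurable]:
  "(\<lambda>(v, x). distributional_transform M v x) \<in> borel_measurable (borel \<Otimes>\<^sub>M borel)"
proof -
  have [measurable]: "(\<lambda>x. prob {..<x}) \<in> borel_measurable borel"
    by (intro borel_measurable_mono monoI prob_lessThan_mono)
  have [measurable]: "(\<lambda>x. prob {..x}) \<in> borel_measurable borel"
    by (intro borel_measurable_mono monoI finite_measure_mono) auto
  show ?thesis
    unfolding distributional_transform_def by measurable
qed

lemma quantile_exists:
  assumes "0 < u" "u < 1"
  obtains x where "prob {..<x} \<le> u" "u \<le> prob {..x}"
proof -
  interpret cdf_distribution M ..
  define x where "x = Inf {x. u \<le> cdf M x}"
  have x: "u \<le> cdf M y \<longleftrightarrow> x \<le> y" for y
    unfolding x_def using assms by (rule pseudoinverse)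
  have "prob {..<x} \<le> u"
  proof (rule tendsto_upperbound[OF cdf_at_left])
    show "eventually (\<lambda>y. cdf M y \<le> u) (at_left x)"
    proof -
      have "cdf M y \<le> u" if "y < x" for y
        using x[of y] that by linarith
      then show ?thesis
        unfolding eventually_at_left_field by (intro exI[of _ "x - 1"]) auto
    qed
  qed simp
  moreover have "u \<le> prob {..x}"
    using x[of x] by (simp add: cdf_def)
  ultimately show thesis by (rule that)
qed

text \<open>Spreading each atom of the law over the jump of the cdf that it causes, by an independent uniform
  variable, turns every law into the uniform one.\<close>

lemma distr_distributional_transform:
  "distr (unif \<Otimes>\<^sub>M M) borel (\<lambda>(v, x). distributional_transform M v x) = unif" (is "distr ?P borel ?T = _")
proof (rule unif_eqI)
  interpret U: real_distribution unif by (rule real_distribution_unif)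
  interpret P: pair_prob_space unif M ..
  have sets_P: "sets ?P = sets (borel \<Otimes>\<^sub>M borel)"
    by (intro sets_pair_measure_cong) auto
  have space_P: "space ?P = UNIV"
    by (simp add: space_pair_measure)
  have T: "?T \<in> borel_measurable ?P"
    unfolding measurable_cong_sets[OF sets_P refl] by (rule measurable_distributional_transform)
  show "real_distribution (distr ?P borel ?T)"
    using T by (rule P.real_distribution_distr)
  fix u :: real assume u: "0 < u" "u < 1"
  obtain x where x: "prob {..<x} \<le> u" "u \<le> prob {..x}"
    using quantile_exists[OF u] .
  define g j where "g = prob {..<x}" and "j = prob {x}"
  \<comment> \<open>the fraction of the atom at \<open>x\<close> that has to lie below \<open>u\<close>\<close>
  define w where "w = (if j = 0 then 0 else (u - g) / j)"
  have gj: "g \<le> u" "u \<le> g + j" "0 \<le> j"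
    using x by (simp_all add: g_def j_def prob_atMost_eq)
  have w: "0 \<le> w" "w \<le> 1" and gwj: "g + w * j = u"
    using gj by (auto simp: w_def field_simps)
  have T_x: "?T (v, x) = g + v * j" for v
    by (simp add: distributional_transform_def g_def j_def prob_atMost_eq algebra_simps)
  have meas_w: "U.prob {0..w} = w" "U.prob {..w} = w"
  proof -
    show "U.prob {0..w} = w" using w by (subst measure_unif_subset) auto
    show "U.prob {..w} = w" using cdf_unif[OF w] by (simp add: cdf_def)
  qed
  have times: "measure ?P (A \<times> B) = U.prob A * prob B" if "A \<in> sets borel" "B \<in> sets borel" for A B
    using that by (intro measure_Times) (auto intro: U.prob_space_axioms prob_space_axioms)
  have in_P [simp]: "A \<times> B \<in> sets ?P" if "A \<in> sets borel" "B \<in> sets borel" for A B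
    using that by (intro pair_measureI) auto
  show "measure (distr ?P borel ?T) {..<u} \<le> u"
  proof -
    have sub: "?T -` {..<u} \<inter> space ?P \<subseteq> (UNIV \<times> {..<x} \<union> {..w} \<times> {x}) \<union> (- {0..1}) \<times> UNIV"
    proof (rule subsetI, rule ccontr)
      fix p assume p: "p \<in> ?T -` {..<u} \<inter> space ?P" "p \<notin> (UNIV \<times> {..<x} \<union> {..w} \<times> {x}) \<union> (- {0..1}) \<times> UNIV"
      obtain v y where vy: "p = (v, y)" by (cases p)
      have lt: "?T (v, y) < u" using p by (simp add: vy)
      have y: "\<not> (y = x \<and> v \<le> w)" "\<not> y < x" and v: "0 \<le> v" "v \<le> 1"
        using p by (auto simp: vy)
      show False
      proof (cases "y = x")
        case True
        then have "v * j < w * j" using lt T_x[of v] gwj by simp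
        then have "v < w" using gj(3) by (simp add: mult_less_cancel_right)
        then show False using y True by simp
      next
        case False
        then have "x < y" using y by simp
        have "u \<le> prob {..x}" by fact
        also have "\<dots> \<le> prob {..<y}" using \<open>x < y\<close> by (rule prob_atMost_le_lessThan)
        also have "\<dots> \<le> ?T (v, y)" using distributional_transform_bounds(1)[OF v] by simp
        finally show False using lt by simp
      qed
    qed
    have "measure (distr ?P borel ?T) {..<u} = measure ?P (?T -` {..<u} \<inter> space ?P)"
      using T by (rule measure_distr) simp
    also have "\<dots> \<le> measure ?P ((UNIV \<times> {..<x} \<union> {..w} \<times> {x}) \<union> (- {0..1}) \<times> UNIV)"
      by (rule P.finite_measure_mono[OF sub]) auto
    also have "\<dots> \<le> measure ?P (UNIV \<times> {..<x} \<union> {..w} \<times> {x}) + measure ?P ((- {0..1}) \<times> UNIV)"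
      by (rule measure_Un_le) auto
    also have "\<dots> \<le> (measure ?P (UNIV \<times> {..<x}) + measure ?P ({..w} \<times> {x})) + measure ?P ((- {0..1}) \<times> UNIV)"
      by (intro add_right_mono measure_Un_le) auto
    also have "U.prob (- {0..1}) = 0"
      by (simp add: measure_unif)
    then have "(measure ?P (UNIV \<times> {..<x}) + measure ?P ({..w} \<times> {x})) + measure ?P ((- {0..1}) \<times> UNIV) = g + w * j"
      using U.prob_space prob_space by (simp add: times meas_w g_def j_def)
    finally show ?thesis by (simp add: gwj)
  qed
  show "u \<le> measure (distr ?P borel ?T) {..u}"
  proof -
    have sub: "{0..1} \<times> {..<x} \<union> {0..w} \<times> {x} \<subseteq> ?T -` {..u} \<inter> space ?P"
    proof (intro Un_least subsetI)
      fix p :: "real \<times> real" assume "p \<in> {0..1} \<times> {..<x}"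
      then obtain v y where p: "p = (v, y)" and v: "v \<in> {0..1}" and y: "y < x" by auto
      have "?T (v, y) \<le> prob {..y}" using distributional_transform_bounds(2)[of v y] v by simp
      also have "\<dots> \<le> g" unfolding g_def using y by (rule prob_atMost_le_lessThan)
      finally show "p \<in> ?T -` {..u} \<inter> space ?P" using gj by (simp add: p space_P)
    next
      fix p assume "p \<in> {0..w} \<times> {x}"
      then obtain v where p: "p = (v, x)" and v: "v \<in> {0..w}" by auto
      have "v * j \<le> w * j" using gj(3) v by (intro mult_right_mono) auto
      then show "p \<in> ?T -` {..u} \<inter> space ?P" using gwj T_x[of v] by (simp add: p space_P)
    qed
    have "u = measure ?P ({0..1} \<times> {..<x}) + measure ?P ({0..w} \<times> {x})"
      using gwj by (simp add: times meas_w g_def j_def measure_unif)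
    also have "\<dots> = measure ?P ({0..1} \<times> {..<x} \<union> {0..w} \<times> {x})"
      by (rule P.finite_measure_Union[symmetric]) auto
    also have "\<dots> \<le> measure ?P (?T -` {..u} \<inter> space ?P)"
      by (rule P.finite_measure_mono[OF sub]) (rule measurable_sets[OF T], simp)
    also have "\<dots> = measure (distr ?P borel ?T) {..u}"
      using T by (rule measure_distr[symmetric]) simp
    finally show ?thesis .
  qed
qed

end

text \<open>A coupling of single observations extends to independent sequences of them. Given the first components,
  the preimage of a box is a box, so that its measure is a product and factors under the integral.\<close>

lemma distr_iid_pair:
  assumes A: "real_distribution A" and B: "real_distribution B" and C: "real_distribution C"
    and f: "f \<in> borel_measurable (A \<Otimes>\<^sub>M B)" and law: "distr (A \<Otimes>\<^sub>M B) borel f = C"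
  shows "(\<lambda>(a, b). \<lambda>i\<in>{1..n}. f (a i, b i)) \<in> iid A n \<Otimes>\<^sub>M iid B n \<rightarrow>\<^sub>M iid C n" (is "?\<phi> \<in> ?P \<rightarrow>\<^sub>M _")
    and "distr (iid A n \<Otimes>\<^sub>M iid B n) (iid C n) (\<lambda>(a, b). \<lambda>i\<in>{1..n}. f (a i, b i)) = iid C n"
proof -
  interpret A: real_distribution A by fact
  interpret B: real_distribution B by fact
  interpret C: real_distribution C by fact
  interpret PA: finite_product_prob_space "\<lambda>_::nat. A" "{1..n}" by standard simp
  interpret PB: finite_product_prob_space "\<lambda>_::nat. B" "{1..n}" by standard simp
  interpret PC: finite_product_prob_space "\<lambda>_::nat. C" "{1..n}" by standard simp
  have f': "(\<lambda>p. f (fst p i, snd p i)) \<in> ?P \<rightarrow>\<^sub>M C" if "i \<in> {1..n}" for i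
  proof -
    have "(\<lambda>p. (fst p i, snd p i)) \<in> ?P \<rightarrow>\<^sub>M A \<Otimes>\<^sub>M B"
      using that by measurable
    from measurable_compose[OF this f] show ?thesis
      by (simp add: measurable_cong_sets[OF refl C.events_eq_borel])
  qed
  then show \<phi>: "?\<phi> \<in> ?P \<rightarrow>\<^sub>M iid C n"
    unfolding case_prod_beta by (intro measurable_restrict)
  show "distr ?P (iid C n) ?\<phi> = iid C n"
  proof (rule PC.PiM_eqI)
    fix E assume E: "\<And>i. i \<in> {1..n} \<Longrightarrow> E i \<in> sets C"
    define G where "G i = f -` E i \<inter> space (A \<Otimes>\<^sub>M B)" for i
    have G: "G i \<in> sets (A \<Otimes>\<^sub>M B)" if "i \<in> {1..n}" for i
      unfolding G_def using measurable_sets[OF f, of "E i"] E[OF that] by simp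
    let ?S = "?\<phi> -` PiE {1..n} E \<inter> space ?P"
    have PiE_E: "PiE {1..n} E \<in> sets (iid C n)"
      using E by (intro sets_PiM_I_finite) auto
    have S: "?S \<in> sets ?P"
      by (rule measurable_sets[OF \<phi> PiE_E])
    have slice: "Pair a -` ?S = PiE {1..n} (\<lambda>i. Pair (a i) -` G i)" if "a \<in> space (iid A n)" for a
      using that by (auto simp: G_def space_pair_measure space_PiM PiE_def Pi_iff simp del: atLeastAtMost_iff)
    have "distr ?P (iid C n) ?\<phi> (PiE {1..n} E) = ?P ?S"
      by (rule emeasure_distr[OF \<phi> PiE_E])
    also have "\<dots> = (\<integral>\<^sup>+a. iid B n (Pair a -` ?S) \<partial>iid A n)"
      by (rule PB.emeasure_pair_measure_alt[OF S])
    also have "\<dots> = (\<integral>\<^sup>+a. (\<Prod>i\<in>{1..n}. B (Pair (a i) -` G i)) \<partial>iid A n)"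
    proof (rule nn_integral_cong)
      fix a assume "a \<in> space (iid A n)"
      then show "iid B n (Pair a -` ?S) = (\<Prod>i\<in>{1..n}. B (Pair (a i) -` G i))"
        using G by (simp only: slice) (intro PB.emeasure_PiM sets_Pair1, auto)
    qed
    also have "\<dots> = (\<Prod>i\<in>{1..n}. \<integral>\<^sup>+x. B (Pair x -` G i) \<partial>A)"
      using G by (intro PA.product_nn_integral_prod B.measurable_emeasure_Pair) auto
    also have "\<dots> = (\<Prod>i\<in>{1..n}. C (E i))"
    proof (rule prod.cong[OF refl])
      fix i assume i: "i \<in> {1..n}"
      have "(\<integral>\<^sup>+x. B (Pair x -` G i) \<partial>A) = (A \<Otimes>\<^sub>M B) (G i)"
        by (rule B.emeasure_pair_measure_alt[OF G[OF i], symmetric])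
      also have "\<dots> = distr (A \<Otimes>\<^sub>M B) borel f (E i)"
        unfolding G_def using E[OF i] f by (intro emeasure_distr[symmetric]) auto
      finally show "(\<integral>\<^sup>+x. B (Pair x -` G i) \<partial>A) = C (E i)" by (simp only: law)
    qed
    finally show "distr ?P (iid C n) ?\<phi> (PiE {1..n} E) = (\<Prod>i\<in>{1..n}. C (E i))" .
  qed simp_all
qed

text \<open>Ties among uniform variables have probability zero, so wins with a tie can be discarded. For fixed
  randomization \<open>v\<close>, the slice of the event of winning without a tie consists of winning observations of a
  nonrandomized rule: a smaller observation than the chosen one would have a transform that is at most the
  transform of the chosen one, hence tie with it.\<close>

lemma full_info_value_le_iid_value:
  assumes \<nu>: "real_distribution \<nu>" and "1 \<le> n"
  shows "full_info_value n \<le> iid_value \<nu> n"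
  unfolding full_info_value_def iid_value_def
proof (rule value_leI[OF \<open>1 \<le> n\<close>])
  interpret \<nu>: real_distribution \<nu> by fact
  interpret U: prob_space "iid unif n" by (rule iid_prob_space[OF real_distribution_unif])
  have coord: "coord i \<in> borel_measurable (iid unif n)" if "i \<in> {1..n}" for i
    using that by (intro measurable_coord_iid) auto
  let ?T = "distributional_transform \<nu>"
  let ?\<phi> = "\<lambda>(v, x). \<lambda>i\<in>{1..n}. ?T (v i) (x i)"
  have T: "(\<lambda>(v, x). ?T v x) \<in> borel_measurable (unif \<Otimes>\<^sub>M \<nu>)"
    using \<nu>.measurable_distributional_transform
    by (subst measurable_cong_sets[OF sets_pair_measure_cong refl]) auto
  note \<phi> = distr_iid_pair[OF real_distribution_unif \<nu> real_distribution_unif T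
      \<nu>.distr_distributional_transform, of n, unfolded prod.case]
  fix \<tau> assume \<tau>: "\<tau> \<in> stopping_rules (iid unif n) coord n"
  let ?W = "win_event (iid unif n) coord n \<tau>" and ?E = "tie_event (iid unif n) coord n"
  have W: "?W \<in> sets (iid unif n)" and E: "?E \<in> sets (iid unif n)"
    using win_event_measurable[OF \<tau> coord] tie_event_measurable[OF coord] by auto
  define S where "S = ?\<phi> -` (?W - ?E) \<inter> space (iid unif n \<Otimes>\<^sub>M iid \<nu> n)"
  have S: "S \<in> sets (iid unif n \<Otimes>\<^sub>M iid \<nu> n)"
    unfolding S_def using measurable_sets[OF \<phi>(1) sets.Diff[OF W E]] .
  have slice: "measure (iid \<nu> n) (Pair v -` S) \<le> best_choice_value (iid \<nu> n) coord n"
    if v: "\<forall>i\<in>{1..n}. 0 < v i \<and> v i < 1" for v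
  proof -
    let ?\<psi> = "\<lambda>x. \<lambda>i\<in>{1..n}. ?T (v i) (x i)"
    define \<rho> where "\<rho> x = \<tau> (?\<psi> x)" for x
    have space: "?\<psi> x \<in> space (iid unif n)" for x
      by (simp add: space_PiM)
    have \<rho>: "\<rho> \<in> stopping_rules (iid \<nu> n) coord n"
    proof (rule stopping_rules_transport[OF \<tau>, where \<phi> = ?\<psi> and g = "\<lambda>t. t"])
      fix t i assume ti: "1 \<le> t" "t < n" "i \<in> {1..t}"
      have "?T (v i) \<in> borel_measurable borel"
        using measurable_compose[OF measurable_Pair1'[of "v i" borel borel] \<nu>.measurable_distributional_transform] by simp
      from measurable_compose[OF measurable_natural_filtration[OF ti(3)] this]
      show "(\<lambda>x. coord i (?\<psi> x)) \<in> borel_measurable (natural_filtration (iid \<nu> n) coord t)"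
        using ti by simp
    qed (use space stopping_rules_range[OF \<tau> space] in \<open>auto simp: \<rho>_def\<close>)
    have "Pair v -` S \<subseteq> win_event (iid \<nu> n) coord n \<rho>"
    proof
      fix x assume "x \<in> Pair v -` S"
      then have x: "x \<in> space (iid \<nu> n)" and win: "?\<psi> x \<in> ?W" and no_tie: "?\<psi> x \<notin> ?E"
        by (auto simp: S_def space_pair_measure split: if_splits)
      let ?u = "?\<psi> x"
      let ?s = "\<rho> x"
      have s: "?s \<in> {1..n}"
        unfolding \<rho>_def by (rule stopping_rules_range[OF \<tau> space])
      have min: "?u ?s \<le> ?u j" if "j \<in> {1..n}" for j
        using win that unfolding win_event_def \<rho>_def by blast
      have "x ?s \<le> x j" if j: "j \<in> {1..n}" for j
      proof (rule ccontr)
        assume "\<not> x ?s \<le> x j"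
        then have lt: "x j < x ?s" by simp
        have "?T (v j) (x j) \<le> \<nu>.prob {..x j}"
          using v j by (intro \<nu>.distributional_transform_bounds) (auto intro: less_imp_le)
        also have "\<dots> \<le> \<nu>.prob {..<x ?s}"
          using lt by (rule \<nu>.prob_atMost_le_lessThan)
        also have "\<dots> \<le> ?T (v ?s) (x ?s)"
          using v s by (intro \<nu>.distributional_transform_bounds) (auto intro: less_imp_le)
        finally have "?u j \<le> ?u ?s"
          using j s by simp
        then have "?u j \<le> ?u l" if "l \<in> {1..n}" for l
          using min[OF that] by linarith
        moreover have "?s \<noteq> j" using lt by auto
        ultimately have "?u \<in> ?E"
          using space min s j unfolding tie_event_def by blast
        then show False using no_tie by blast
      qed
      then show "x \<in> win_event (iid \<nu> n) coord n \<rho>"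
        using x unfolding win_event_def by blast
    qed
    then have "measure (iid \<nu> n) (Pair v -` S) \<le> measure (iid \<nu> n) (win_event (iid \<nu> n) coord n \<rho>)"
      by (intro finite_measure.finite_measure_mono prob_space.finite_measure iid_prob_space \<nu>
          win_event_measurable[OF \<rho>] measurable_coord_iid) auto
    also have "\<dots> = win_prob (iid \<nu> n) coord n \<rho>"
      by (rule win_prob_eq[symmetric]) (rule stopping_rules_range[OF \<rho>])
    also have "\<dots> \<le> best_choice_value (iid \<nu> n) coord n"
      by (rule win_prob_le_value[OF iid_prob_space[OF \<nu>] \<rho>])
    finally show ?thesis .
  qed
  have "win_prob (iid unif n) coord n \<tau> = U.prob ?W"
    by (rule win_prob_eq) (rule stopping_rules_range[OF \<tau>])
  also have "\<dots> \<le> U.prob ((?W - ?E) \<union> ?E)"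
    using W E by (intro U.finite_measure_mono) auto
  also have "\<dots> \<le> U.prob (?W - ?E) + U.prob ?E"
    using W E by (intro measure_Un_le) auto
  also have "\<dots> = U.prob (?W - ?E)"
    using tie_prob_unif[OF \<open>1 \<le> n\<close>] by (simp add: tie_prob_eq)
  also have "\<dots> = measure (iid unif n \<Otimes>\<^sub>M iid \<nu> n) S"
    unfolding S_def using measure_distr[OF \<phi>(1) sets.Diff[OF W E]] by (simp only: \<phi>(2))
  also have "\<dots> = (LINT v|iid unif n. measure (iid \<nu> n) (Pair v -` S))"
    by (rule measure_pair_measure(2)[OF U.prob_space_axioms iid_prob_space[OF \<nu>] S])
  also have "\<dots> \<le> best_choice_value (iid \<nu> n) coord n"
  proof (rule U.integral_le_const)
    show "integrable (iid unif n) (\<lambda>v. measure (iid \<nu> n) (Pair v -` S))"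
      by (rule measure_pair_measure(1)[OF U.prob_space_axioms iid_prob_space[OF \<nu>] S])
    show "AE v in iid unif n. measure (iid \<nu> n) (Pair v -` S) \<le> best_choice_value (iid \<nu> n) coord n"
      using AE_iid_coordinates[OF real_distribution_unif AE_unif, of n]
      by eventually_elim (rule slice)
  qed
  finally show "win_prob (iid unif n) coord n \<tau> \<le> best_choice_value (iid \<nu> n) coord n" .
qed

section \<open>Ties help by at most their probability\<close>

definition quantile :: "real measure \<Rightarrow> real \<Rightarrow> real" where
  "quantile \<nu> u = (if u \<in> {0<..<1} then Inf {x. u \<le> cdf \<nu> x} else 0)"

context real_distribution
begin

lemma quantile_le_iff: "0 < u \<Longrightarrow> u < 1 \<Longrightarrow> quantile M u \<le> x \<longleftrightarrow> u \<le> cdf M x"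
proof -
  assume u: "0 < u" "u < 1"
  interpret cdf_distribution M ..
  show ?thesis using pseudoinverse[OF u, of x, symmetric] u by (simp add: quantile_def)
qed

lemma measurable_quantile: "quantile M \<in> borel_measurable borel"
proof -
  interpret cdf_distribution M ..
  have "(\<lambda>u. if u \<in> {0<..<1} then Inf {x. u \<le> cdf M x} else 0) \<in> borel_measurable borel"
    using measurable_CI by (subst measurable_restrict_space_iff[symmetric]) auto
  then show ?thesis by (simp add: quantile_def[abs_def])
qed

lemma distr_quantile: "distr unif borel (quantile M) = M"
proof (rule cdf_unique)
  interpret U: real_distribution unif by (rule real_distribution_unif)
  have q: "quantile M \<in> borel_measurable unif"
    using measurable_quantile by simp
  show "real_distribution (distr unif borel (quantile M))"
    using q by (rule U.real_distribution_distr)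
  show "real_distribution M" ..
  have "cdf (distr unif borel (quantile M)) x = cdf M x" for x
  proof -
    have "U.prob (quantile M -` {..x} \<inter> space unif) = U.prob {..cdf M x}"
    proof (rule U.finite_measure_eq_AE)
      show "AE u in unif. u \<in> quantile M -` {..x} \<inter> space unif \<longleftrightarrow> u \<in> {..cdf M x}"
        using AE_unif by eventually_elim (simp add: quantile_le_iff)
      show "quantile M -` {..x} \<inter> space unif \<in> U.events"
        by (rule measurable_sets[OF q]) simp
    qed simp
    also have "\<dots> = cdf M x"
      using cdf_unif[OF cdf_nonneg cdf_bounded_prob] by (simp add: cdf_def)
    finally show ?thesis
      using measure_distr[OF q, of "{..x}"] by (simp add: cdf_def)
  qed
  then show "cdf (distr unif borel (quantile M)) = cdf M" by blast
qed

end

text \<open>Monotonicity of the quantile function forces a tie among the observations whenever the rule picks a smallest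
  observation without picking the smallest uniform variable.\<close>

lemma iid_value_le_full_info_value_plus_tie:
  assumes \<nu>: "real_distribution \<nu>" and "1 \<le> n"
  shows "iid_value \<nu> n \<le> full_info_value n + tie_prob (iid \<nu> n) coord n"
  unfolding iid_value_def
proof (rule value_leI[OF \<open>1 \<le> n\<close>])
  interpret \<nu>: real_distribution \<nu> by fact
  interpret u: real_distribution unif by (rule real_distribution_unif)
  interpret U: prob_space "iid unif n" by (rule iid_prob_space[OF real_distribution_unif])
  let ?q = "quantile \<nu>"
  let ?\<phi> = "compose {1..n} ?q"
  have q: "?q \<in> unif \<rightarrow>\<^sub>M \<nu>"
    using \<nu>.measurable_quantile by (simp cong: measurable_cong_sets)
  have "distr unif \<nu> ?q = distr unif borel ?q"
    by (rule distr_cong) simp_all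
  then have law: "distr (iid unif n) (iid \<nu> n) ?\<phi> = iid \<nu> n"
    using q \<nu>.distr_quantile
    by (subst distr_PiM_finite_prob_space') (simp_all add: u.prob_space_axioms \<nu>.prob_space_axioms)
  have \<phi>: "?\<phi> \<in> iid unif n \<rightarrow>\<^sub>M iid \<nu> n"
    unfolding compose_def
    by (intro measurable_restrict measurable_compose[OF measurable_component_singleton[where M = "\<lambda>_. unif"] q])
  fix \<tau> assume \<tau>: "\<tau> \<in> stopping_rules (iid \<nu> n) coord n"
  let ?W = "win_event (iid \<nu> n) coord n \<tau>" and ?E = "tie_event (iid \<nu> n) coord n"
  have W: "?W \<in> sets (iid \<nu> n)" and E: "?E \<in> sets (iid \<nu> n)"
    using win_event_measurable[OF \<tau> measurable_coord_iid] tie_event_measurable[OF measurable_coord_iid] by auto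
  define \<rho> where "\<rho> u = \<tau> (?\<phi> u)" for u
  have space: "?\<phi> u \<in> space (iid \<nu> n)" for u
    by (simp add: space_PiM compose_def)
  have \<rho>: "\<rho> \<in> stopping_rules (iid unif n) coord n"
  proof (rule stopping_rules_transport[OF \<tau>, where \<phi> = ?\<phi> and g = "\<lambda>t. t"])
    fix t i assume ti: "1 \<le> t" "t < n" "i \<in> {1..t}"
    from measurable_compose[OF measurable_natural_filtration[OF ti(3)] \<nu>.measurable_quantile]
    show "(\<lambda>u. coord i (?\<phi> u)) \<in> borel_measurable (natural_filtration (iid unif n) coord t)"
      using ti by (simp add: compose_def)
  qed (use space stopping_rules_range[OF \<tau> space] in \<open>auto simp: \<rho>_def\<close>)
  let ?V = "win_event (iid unif n) coord n \<rho>"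
  have V: "?V \<in> sets (iid unif n)"
    by (intro win_event_measurable[OF \<rho>] measurable_coord_iid) auto
  have W': "?\<phi> -` ?W \<inter> space (iid unif n) \<in> sets (iid unif n)" and E': "?\<phi> -` ?E \<inter> space (iid unif n) \<in> sets (iid unif n)"
    using measurable_sets[OF \<phi>] W E by auto
  have cover: "u \<in> ?V \<union> (?\<phi> -` ?E \<inter> space (iid unif n))"
    if u: "\<forall>i\<in>{1..n}. 0 < u i \<and> u i < 1" and "u \<in> ?\<phi> -` ?W \<inter> space (iid unif n)" for u
  proof (rule ccontr)
    let ?s = "\<rho> u"
    assume no: "u \<notin> ?V \<union> (?\<phi> -` ?E \<inter> space (iid unif n))"
    have s: "?s \<in> {1..n}"
      unfolding \<rho>_def by (rule stopping_rules_range[OF \<tau> space])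
    have min: "?\<phi> u ?s \<le> ?\<phi> u j" if "j \<in> {1..n}" for j
      using that \<open>u \<in> ?\<phi> -` ?W \<inter> space (iid unif n)\<close> unfolding win_event_def \<rho>_def by blast
    have "\<not> (\<forall>j\<in>{1..n}. u ?s \<le> u j)"
      using no that(2) unfolding win_event_def by blast
    then obtain j where j: "j \<in> {1..n}" "u j < u ?s"
      unfolding not_le[symmetric] by blast
    have "?q (u j) \<le> ?q (u ?s)"
    proof -
      have "u ?s \<le> cdf \<nu> (?q (u ?s))"
        using \<nu>.quantile_le_iff[of "u ?s" "?q (u ?s)"] u s by simp
      then show ?thesis
        using \<nu>.quantile_le_iff[of "u j"] u j by simp
    qed
    then have "?\<phi> u j \<le> ?\<phi> u ?s"
      using j(1) s by (simp add: compose_def)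
    then have "?\<phi> u j \<le> ?\<phi> u l" if "l \<in> {1..n}" for l
      using min[OF that] by linarith
    moreover have "?s \<noteq> j" using j by auto
    ultimately have "?\<phi> u \<in> ?E"
      using space min s j(1) unfolding tie_event_def by blast
    then show False using no that(2) by blast
  qed
  have "win_prob (iid \<nu> n) coord n \<tau> = measure (iid \<nu> n) ?W"
    by (rule win_prob_eq) (rule stopping_rules_range[OF \<tau>])
  also have "\<dots> = U.prob (?\<phi> -` ?W \<inter> space (iid unif n))"
    using measure_distr[OF \<phi> W] by (simp only: law)
  also have "\<dots> \<le> U.prob (?V \<union> (?\<phi> -` ?E \<inter> space (iid unif n)))"
  proof (rule U.finite_measure_mono_AE)
    show "AE u in iid unif n. u \<in> ?\<phi> -` ?W \<inter> space (iid unif n) \<longrightarrow> u \<in> ?V \<union> (?\<phi> -` ?E \<inter> space (iid unif n))"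
      using AE_iid_coordinates[OF real_distribution_unif AE_unif, of n]
      by eventually_elim (use cover in blast)
  qed (use V E' in blast)
  also have "\<dots> \<le> U.prob ?V + U.prob (?\<phi> -` ?E \<inter> space (iid unif n))"
    using V E' by (rule measure_Un_le)
  also have "U.prob ?V = win_prob (iid unif n) coord n \<rho>"
    by (rule win_prob_eq[symmetric]) (rule stopping_rules_range[OF \<rho>])
  also have "\<dots> \<le> full_info_value n"
    unfolding full_info_value_def iid_value_def by (rule win_prob_le_value[OF U.prob_space_axioms \<rho>])
  also have "U.prob (?\<phi> -` ?E \<inter> space (iid unif n)) = tie_prob (iid \<nu> n) coord n"
    using measure_distr[OF \<phi> E] by (simp only: law tie_prob_eq)
  finally show "win_prob (iid \<nu> n) coord n \<tau> \<le> full_info_value n + tie_prob (iid \<nu> n) coord n"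
    by simp
qed

(* The index 1 is kept in this form, so that boxes with a special first side are recognized. *)
declare One_nat_def [simp del]

section \<open>The price of a wrong first decision\<close>

text \<open>At time 1 the generators of the filtration already form a \<open>\<sigma>\<close>-algebra.\<close>

lemma natural_filtration_first:
  assumes "A \<in> sets (natural_filtration M X 1)"
  shows "\<exists>S \<in> sets borel. A = X 1 -` S \<inter> space M"
proof -
  have "{X i -` A \<inter> space M | i A. i \<in> {1..1::nat} \<and> A \<in> sets borel} = {X 1 -` A \<inter> space M | A. A \<in> sets borel}"
    by auto
  then have "sets (natural_filtration M X 1) = sets (vimage_algebra (space M) (X 1) borel)"
    by (simp add: sets_natural_filtration sets_vimage_algebra)
  also have "\<dots> = {X 1 -` A \<inter> space M | A. A \<in> sets borel}"
    by (rule sets_vimage_algebra2) simp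
  finally show ?thesis using assms by auto
qed

lemma first_decision_set:
  assumes \<tau>: "\<tau> \<in> stopping_rules M X n"
  obtains S where "S \<in> sets borel" "\<And>\<omega>. \<omega> \<in> space M \<Longrightarrow> \<tau> \<omega> = 1 \<longleftrightarrow> X 1 \<omega> \<in> S"
proof -
  have "{\<omega> \<in> space M. \<tau> \<omega> \<le> 1} \<in> sets (natural_filtration M X 1)"
    using \<tau> by (auto simp: stopping_rules_def stopping_time_def pred_def)
  from natural_filtration_first[OF this]
  obtain S where S: "S \<in> sets borel" "{\<omega> \<in> space M. \<tau> \<omega> \<le> 1} = X 1 -` S \<inter> space M"
    by (rule bexE)
  have "\<tau> \<omega> = 1 \<longleftrightarrow> X 1 \<omega> \<in> S" if \<omega>: "\<omega> \<in> space M" for \<omega>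
  proof -
    have "\<tau> \<omega> = 1 \<longleftrightarrow> \<tau> \<omega> \<le> 1"
      using stopping_rules_range[OF \<tau> \<omega>] by auto
    also have "\<dots> \<longleftrightarrow> X 1 \<omega> \<in> S"
      using S(2) \<omega> by blast
    finally show ?thesis .
  qed
  with S(1) show thesis by (rule that)
qed

lemma measure_unif_atLeast: "0 \<le> a \<Longrightarrow> a \<le> 1 \<Longrightarrow> measure unif {a..} = 1 - a"
proof -
  assume "0 \<le> a" "a \<le> 1"
  then have "{0..1} \<inter> {a..} = {a..1}" by auto
  then show ?thesis using \<open>a \<le> 1\<close> by (simp add: measure_unif)
qed

lemma measure_unif_lessThan: "0 \<le> a \<Longrightarrow> a \<le> 1 \<Longrightarrow> measure unif {..<a} = a"
proof -
  assume "0 \<le> a" "a \<le> 1"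
  then have "{0..1} \<inter> {..<a} = {0..<a}" by auto
  then show ?thesis using \<open>0 \<le> a\<close> by (simp add: measure_unif)
qed

lemma measure_unif_atLeastLessThan: "0 \<le> a \<Longrightarrow> a \<le> b \<Longrightarrow> b \<le> 1 \<Longrightarrow> measure unif {a..<b} = b - a"
  by (subst measure_unif_subset) auto

lemma measure_first_box:
  assumes "1 \<le> n" "A \<in> sets borel" "\<And>i. i \<in> {2..n} \<Longrightarrow> B i \<in> sets borel" "\<And>i. i \<in> {2..n} \<Longrightarrow> measure unif (B i) = c"
  shows "measure (iid unif n) (PiE {1..n} (\<lambda>i. if i = 1 then A else B i)) = measure unif A * c ^ (n - 1)"
proof -
  have "measure (iid unif n) (PiE {1..n} (\<lambda>i. if i = 1 then A else B i)) =
      (\<Prod>i\<in>{1..n}. measure unif (if i = 1 then A else B i))"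
    using assms by (intro measure_iid_box[OF real_distribution_unif]) auto
  also have "\<dots> = measure unif A * (\<Prod>i\<in>{2..n}. c)"
  proof -
    have split: "{1..n} = insert 1 {2..n}"
      using \<open>1 \<le> n\<close> by auto
    show ?thesis
      unfolding split using assms(4) by (subst prod.insert) (auto intro!: prod.cong)
  qed
  finally show ?thesis by simp
qed

lemma first_box_iff:
  assumes "1 \<le> n"
  shows "\<omega> \<in> PiE {1..n} (\<lambda>i. if i = 1 then A else B i) \<longleftrightarrow>
    \<omega> \<in> space (iid unif n) \<and> \<omega> 1 \<in> A \<and> (\<forall>i\<in>{2..n}. \<omega> i \<in> B i)"
proof -
  have "{1..n} = insert 1 {2..n}"
    using assms by auto
  then have "(\<forall>i\<in>{1..n}. \<omega> i \<in> (if i = 1 then A else B i)) \<longleftrightarrow> \<omega> 1 \<in> A \<and> (\<forall>i\<in>{2..n}. \<omega> i \<in> B i)"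
    by auto
  then show ?thesis
    by (simp add: space_PiM PiE_def Pi_iff conj_commute conj_left_commute)
qed

text \<open>An estimate from below for the regret of a rule that accepts the first value exactly if it lies in \<open>S\<close>.
  Accepting a first value below \<open>1 / (4 n)\<close> wins with probability at least \<open>3/4\<close>, since all later values are then
  likely to be larger. Accepting one above \<open>3/4\<close> wins with probability at most \<open>(1/4) ^ (n - 1)\<close>, whereas the second
  value is below \<open>1/2\<close> and all later ones above \<open>1/2\<close> with probability \<open>(1/2) ^ (n - 1)\<close>. Correcting both kinds of
  mistake gives a rule that gains at least the stated amount over the given one, and which cannot beat the value.\<close>

lemma first_decision_loss:
  assumes "2 \<le> n" and \<tau>: "\<tau> \<in> stopping_rules (iid unif n) coord n"
    and S: "S \<in> sets borel" and S_iff: "\<And>\<omega>. \<omega> \<in> space (iid unif n) \<Longrightarrow> \<tau> \<omega> = 1 \<longleftrightarrow> \<omega> 1 \<in> S"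
  shows "win_prob (iid unif n) coord n \<tau> +
      (1 / 2) ^ n * (measure unif ({0..<1 / (4 * real n)} - S) + measure unif (S \<inter> {3/4..1})) \<le> full_info_value n"
proof -
  interpret Q: prob_space "iid unif n" by (rule iid_prob_space[OF real_distribution_unif])
  have "1 \<le> n" using \<open>2 \<le> n\<close> by simp
  have first [measurable]: "coord i \<in> borel_measurable (iid unif n)" if "i \<in> {1..n}" for i
    using that by (intro measurable_coord_iid) auto
  define a where "a = 1 / (4 * real n)"
  have a: "0 < a" "a \<le> 1 / 8"
    using \<open>2 \<le> n\<close> by (auto simp: a_def field_simps)
  define L H where "L = {0..<a} - S" and "H = S \<inter> {3/4..1}"
  have LH [measurable]: "L \<in> sets borel" "H \<in> sets borel"
    using S by (auto simp: L_def H_def)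
  define p q where "p = measure unif L" and "q = measure unif H"
  define \<rho> where "\<rho> \<omega> = (if \<omega> 1 \<in> {0..<a} then 1 else if \<omega> 1 \<in> H then 2 else \<tau> \<omega>)" for \<omega>
  have \<rho>: "\<rho> \<in> stopping_rules (iid unif n) coord n"
    unfolding stopping_rules_def
  proof (intro CollectI conjI ballI stopping_timeI)
    show range: "\<rho> \<omega> \<in> {1..n}" if "\<omega> \<in> space (iid unif n)" for \<omega>
      using stopping_rules_range[OF \<tau> that] \<open>2 \<le> n\<close> by (auto simp: \<rho>_def)
    fix t
    let ?F = "natural_filtration (iid unif n) coord t"
    show "Measurable.pred ?F (\<lambda>\<omega>. \<rho> \<omega> \<le> t)"
    proof (cases "t = 0")
      case True
      then have "\<not> \<rho> \<omega> \<le> t" if "\<omega> \<in> space ?F" for \<omega>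
        using range that by force
      then show ?thesis
        by (subst measurable_cong[where g = "\<lambda>_. False"]) auto
    next
      case False
      then have [measurable]: "coord 1 \<in> borel_measurable ?F"
        by (intro measurable_natural_filtration) auto
      have [measurable]: "Measurable.pred ?F (\<lambda>\<omega>. \<tau> \<omega> \<le> t)"
        using \<tau> by (auto simp: stopping_rules_def stopping_time_def)
      have "\<rho> \<omega> \<le> t \<longleftrightarrow> \<omega> 1 \<in> {0..<a} \<or> (\<omega> 1 \<in> H \<and> 2 \<le> t) \<or> (\<omega> 1 \<notin> H \<and> \<tau> \<omega> \<le> t)" for \<omega>
        using False by (auto simp: \<rho>_def)
      then show ?thesis
        by (simp only:) measurable
    qed
  qed
  let ?W = "win_event (iid unif n) coord n"
  have W: "?W \<tau> \<in> Q.events" "?W \<rho> \<in> Q.events"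
    using win_event_measurable[OF \<tau> first] win_event_measurable[OF \<rho> first] by auto
  have win: "win_prob (iid unif n) coord n \<tau> = Q.prob (?W \<tau>)" "win_prob (iid unif n) coord n \<rho> = Q.prob (?W \<rho>)"
    using stopping_rules_range[OF \<tau>] stopping_rules_range[OF \<rho>] by (simp_all only: win_prob_eq)
  \<comment> \<open>the rules differ exactly if the first value is in \<open>L\<close> or in \<open>H\<close>; their wins are compared on these events\<close>
  define R where "R = ?W \<tau> \<inter> {\<omega> \<in> space (iid unif n). \<omega> 1 \<notin> L \<and> \<omega> 1 \<notin> H}"
  define AL where "AL = PiE {1..n} (\<lambda>i. if i = 1 then L else UNIV)"
  define CL where "CL = PiE {1..n} (\<lambda>i. if i = 1 then L else {a..})"
  define BH where "BH = PiE {1..n} (\<lambda>i. if i = 1 then H else {3/4..})"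
  define CH where "CH = PiE {1..n} (\<lambda>i. if i = 1 then H else if i = 2 then {..<1/2} else {1/2..})"
  note box = first_box_iff[OF \<open>1 \<le> n\<close>]
  have [measurable]: "coord 1 \<in> borel_measurable (iid unif n)"
    using \<open>1 \<le> n\<close> by (intro first) simp
  have "{\<omega> \<in> space (iid unif n). \<omega> 1 \<notin> L \<and> \<omega> 1 \<notin> H} \<in> Q.events"
    by measurable
  then have R: "R \<in> Q.events"
    using W by (auto simp: R_def)
  have boxes: "AL \<in> Q.events" "CL \<in> Q.events" "BH \<in> Q.events" "CH \<in> Q.events"
    unfolding AL_def CL_def BH_def CH_def by (intro sets_PiM_I_finite; simp add: LH)+
  have prob: "Q.prob AL = p" "Q.prob CL = p * (1 - a) ^ (n - 1)"
      "Q.prob BH = q * (1 / 4) ^ (n - 1)" "Q.prob CH = q * (1 / 2) ^ (n - 1)"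
  proof -
    have one: "measure unif UNIV = 1"
      using prob_space.prob_space[OF real_distribution.axioms(1)[OF real_distribution_unif]] by simp
    show "Q.prob AL = p"
      unfolding AL_def p_def using measure_first_box[OF \<open>1 \<le> n\<close> LH(1), of "\<lambda>_. UNIV" 1] one by simp
    show "Q.prob CL = p * (1 - a) ^ (n - 1)"
      unfolding CL_def p_def using a by (intro measure_first_box[OF \<open>1 \<le> n\<close> LH(1)] measure_unif_atLeast) auto
    have "measure unif {3/4::real..} = 1/4"
      by (subst measure_unif_atLeast) auto
    then show "Q.prob BH = q * (1 / 4) ^ (n - 1)"
      unfolding BH_def q_def by (intro measure_first_box[OF \<open>1 \<le> n\<close> LH(2)]) auto
    have "measure unif (if i = 2 then {..<1/2} else {1/2..}) = 1/2" for i :: nat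
      using measure_unif_lessThan[of "1/2"] measure_unif_atLeast[of "1/2"] by simp
    then show "Q.prob CH = q * (1 / 2) ^ (n - 1)"
      unfolding CH_def q_def by (intro measure_first_box[OF \<open>1 \<le> n\<close> LH(2)]) auto
  qed
  have "CL \<subseteq> AL"
    by (auto simp: AL_def CL_def box)
  \<comment> \<open>a rule that lets a very small first value pass wins only if a later value is just as small\<close>
  have "?W \<tau> \<subseteq> (R \<union> (AL - CL)) \<union> BH"
  proof
    fix \<omega> assume \<omega>: "\<omega> \<in> ?W \<tau>"
    then have sp: "\<omega> \<in> space (iid unif n)" and min: "\<And>j. j \<in> {1..n} \<Longrightarrow> \<omega> (\<tau> \<omega>) \<le> \<omega> j"
      by (auto simp: win_event_def)
    have range: "\<tau> \<omega> \<in> {1..n}" by (rule stopping_rules_range[OF \<tau> sp])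
    consider "\<omega> 1 \<in> L" | "\<omega> 1 \<in> H" | "\<omega> 1 \<notin> L" "\<omega> 1 \<notin> H" by blast
    then show "\<omega> \<in> (R \<union> (AL - CL)) \<union> BH"
    proof cases
      case 1
      then have "\<tau> \<omega> \<noteq> 1" using S_iff[OF sp] by (simp add: L_def)
      then have "\<tau> \<omega> \<in> {2..n}" using range by auto
      moreover have "\<omega> (\<tau> \<omega>) < a" using min[of 1] 1 \<open>1 \<le> n\<close> by (simp add: L_def)
      ultimately have "\<omega> \<notin> CL" by (force simp: CL_def box)
      moreover have "\<omega> \<in> AL" using sp 1 by (simp add: AL_def box)
      ultimately show ?thesis by blast
    next
      case 2
      then have "\<tau> \<omega> = 1" using S_iff[OF sp] by (simp add: H_def)
      then have "\<omega> j \<in> {3/4..}" if "j \<in> {2..n}" for j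
        using min[of j] 2 that by (simp add: H_def)
      then have "\<omega> \<in> BH" using sp 2 by (simp add: BH_def box)
      then show ?thesis by blast
    next
      case 3
      then show ?thesis using \<omega> sp by (simp add: R_def)
    qed
  qed
  then have "Q.prob (?W \<tau>) \<le> Q.prob ((R \<union> (AL - CL)) \<union> BH)"
    using R boxes by (intro Q.finite_measure_mono) auto
  also have "\<dots> \<le> Q.prob (R \<union> (AL - CL)) + Q.prob BH"
    using R boxes by (intro measure_Un_le) auto
  also have "\<dots> \<le> (Q.prob R + Q.prob (AL - CL)) + Q.prob BH"
    using R boxes by (intro add_right_mono measure_Un_le) auto
  also have "Q.prob (AL - CL) = Q.prob AL - Q.prob CL"
    using boxes \<open>CL \<subseteq> AL\<close> by (intro Q.finite_measure_Diff) auto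
  finally have upper: "Q.prob (?W \<tau>) \<le> Q.prob R + (p - p * (1 - a) ^ (n - 1)) + q * (1 / 4) ^ (n - 1)"
    by (simp add: prob)
  have "(R \<union> CL) \<union> CH \<subseteq> ?W \<rho>"
  proof (intro Un_least subsetI)
    fix \<omega> assume \<omega>: "\<omega> \<in> R"
    then have sp: "\<omega> \<in> space (iid unif n)" and "\<omega> \<in> ?W \<tau>" by (auto simp: R_def)
    have "\<rho> \<omega> = \<tau> \<omega>"
      using \<omega> S_iff[OF sp] by (auto simp: R_def \<rho>_def L_def)
    then show "\<omega> \<in> ?W \<rho>" using \<open>\<omega> \<in> ?W \<tau>\<close> by (simp add: win_event_def)
  next
    fix \<omega> assume "\<omega> \<in> CL"
    then have sp: "\<omega> \<in> space (iid unif n)" and 1: "\<omega> 1 \<in> {0..<a}" and ge: "\<And>j. j \<in> {2..n} \<Longrightarrow> a \<le> \<omega> j"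
      by (auto simp: CL_def box L_def)
    have "\<omega> 1 \<le> \<omega> j" if "j \<in> {1..n}" for j
    proof (cases "j = 1")
      case False
      then have "a \<le> \<omega> j" using that by (intro ge) auto
      then show ?thesis using 1 by simp
    qed simp
    then show "\<omega> \<in> ?W \<rho>" using sp 1 by (simp add: win_event_def \<rho>_def)
  next
    fix \<omega> assume "\<omega> \<in> CH"
    then have sp: "\<omega> \<in> space (iid unif n)" and 1: "\<omega> 1 \<in> H"
      and other: "\<And>j. j \<in> {2..n} \<Longrightarrow> \<omega> j \<in> (if j = 2 then {..<1/2} else {1/2..})"
      by (auto simp: CH_def box)
    have 2: "\<omega> 2 < 1/2" using other[of 2] \<open>2 \<le> n\<close> by simp
    have "\<omega> 2 \<le> \<omega> j" if j: "j \<in> {1..n}" for j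
    proof -
      have "j = 1 \<or> j = 2 \<or> j \<in> {2..n} \<and> j \<noteq> 2" using j by auto
      then consider "j = 1" | "j = 2" | "j \<in> {2..n}" "j \<noteq> 2" by blast
      then show ?thesis
      proof cases
        case 1
        then show ?thesis using 2 \<open>\<omega> 1 \<in> H\<close> by (simp add: H_def)
      next
        case 3
        then show ?thesis using 2 other[of j] by simp
      qed simp
    qed
    moreover have "\<rho> \<omega> = 2" using 1 a by (auto simp: \<rho>_def H_def)
    ultimately show "\<omega> \<in> ?W \<rho>" using sp by (simp add: win_event_def)
  qed
  then have "Q.prob ((R \<union> CL) \<union> CH) \<le> Q.prob (?W \<rho>)"
    using W by (intro Q.finite_measure_mono) auto
  moreover have "Q.prob ((R \<union> CL) \<union> CH) = Q.prob R + Q.prob CL + Q.prob CH"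
  proof -
    have "(R \<union> CL) \<inter> CH = {}" "R \<inter> CL = {}"
      using a by (auto simp: R_def CL_def CH_def box L_def H_def)
    then show ?thesis
      using R boxes by (simp add: Q.finite_measure_Union)
  qed
  ultimately have lower: "Q.prob R + p * (1 - a) ^ (n - 1) + q * (1 / 2) ^ (n - 1) \<le> Q.prob (?W \<rho>)"
    by (simp add: prob)
  have "Q.prob (?W \<rho>) \<le> full_info_value n"
    using win_prob_le_value[OF Q.prob_space_axioms \<rho>] by (simp add: win full_info_value_def iid_value_def)
  moreover have "(1 / 2) ^ n * (p + q) \<le> p * (2 * (1 - a) ^ (n - 1) - 1) + q * ((1 / 2) ^ (n - 1) - (1 / 4) ^ (n - 1))"
  proof -
    have "3 / 4 \<le> 1 + real (n - 1) * (- a)"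
      using \<open>2 \<le> n\<close> by (simp add: a_def of_nat_diff field_simps)
    also have "\<dots> \<le> (1 + (- a)) ^ (n - 1)"
      using a by (intro Bernoulli_inequality) simp
    finally have "1 / 2 \<le> 2 * (1 - a) ^ (n - 1) - 1" by simp
    moreover have "(1 / 2 :: real) ^ n \<le> 1 / 2"
      using power_decreasing[of 1 n "1/2 :: real"] \<open>1 \<le> n\<close> by simp
    ultimately have "(1 / 2) ^ n * p \<le> (2 * (1 - a) ^ (n - 1) - 1) * p"
      by (intro mult_right_mono) (simp_all add: p_def)
    moreover have "(1 / 2) ^ n * q \<le> ((1 / 2) ^ (n - 1) - (1 / 4) ^ (n - 1)) * q"
    proof (intro mult_right_mono)
      obtain k where n: "n = Suc (Suc k)"
        using \<open>2 \<le> n\<close> by (metis add_2_eq_Suc le_Suc_ex)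
      have "(1 / 4 :: real) ^ k \<le> (1 / 2) ^ k"
        by (rule power_mono) auto
      then show "(1 / 2 :: real) ^ n \<le> (1 / 2) ^ (n - 1) - (1 / 4) ^ (n - 1)"
        by (simp add: n)
    qed (simp add: q_def)
    ultimately show ?thesis by (simp add: algebra_simps)
  qed
  ultimately show ?thesis
    using upper lower unfolding win p_def[symmetric] q_def[symmetric] L_def[symmetric] H_def[symmetric] a_def[symmetric]
    by (simp add: algebra_simps)
qed

section \<open>Scaling\<close>

lemma unif_scale:
  assumes "0 < m" "m \<le> 1" and B: "B \<in> sets borel"
  shows "measure unif (B \<inter> {..m}) = m * measure unif {x. m * x \<in> B}"
proof -
  have [measurable]: "B \<in> sets borel" by fact
  have B': "{x. m * x \<in> B} \<in> sets borel" by measurable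
  have "measure unif (B \<inter> {..m}) = (LINT x|lborel. indicator ({0..1} \<inter> (B \<inter> {..m})) x)"
    using B by (simp add: measure_unif)
  also have "\<dots> = m * (LINT x|lborel. indicator ({0..1} \<inter> (B \<inter> {..m})) (0 + m * x))"
    using \<open>0 < m\<close> by (subst lborel_integral_real_affine[where c = m and t = 0]) auto
  also have "(\<lambda>x. indicator ({0..1} \<inter> (B \<inter> {..m})) (0 + m * x) :: real) = indicator ({0..1} \<inter> {x. m * x \<in> B})"
    using assms by (auto simp: fun_eq_iff zero_le_mult_iff mult_le_cancel_left1 split: split_indicator intro: mult_le_one)
  also have "(LINT x|lborel. indicator ({0..1} \<inter> {x. m * x \<in> B}) x :: real) = measure unif {x. m * x \<in> B}"
    using B' by (simp add: measure_unif)
  finally show ?thesis .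
qed

text \<open>Uniform observations that all lie below \<open>m\<close> are, conditionally on this, \<open>m\<close> times uniform observations.\<close>

lemma iid_unif_scale:
  assumes m: "0 < m" "m \<le> 1" and E: "E \<in> sets (iid unif n)"
  shows "measure (iid unif n) (E \<inter> PiE {1..n} (\<lambda>_. {..m})) =
    m ^ n * measure (iid unif n) {y \<in> space (iid unif n). (\<lambda>i\<in>{1..n}. m * y i) \<in> E}"
proof -
  interpret u: real_distribution unif by (rule real_distribution_unif)
  interpret Q: prob_space "iid unif n" by (rule iid_prob_space[OF real_distribution_unif])
  let ?N = "distr unif borel (\<lambda>x. m * x)"
  interpret N: real_distribution ?N
    by (rule u.real_distribution_distr) simp
  interpret PN: finite_product_prob_space "\<lambda>_::nat. ?N" "{1..n}" by standard simp
  let ?B = "PiE {1..n} (\<lambda>_. {..m})"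
  have sets_N: "sets (iid ?N n) = sets (iid unif n)"
    by (intro sets_PiM_cong) simp_all
  have B: "?B \<in> sets (iid unif n)"
    by (intro sets_PiM_I_finite) auto
  have "measure (iid unif n) ?B = (\<Prod>i\<in>{1..n}. cdf unif m)"
    unfolding cdf_def by (rule measure_iid_box[OF real_distribution_unif]) simp
  then have prob_B: "measure (iid unif n) ?B = m ^ n"
    using m by (simp add: cdf_unif)
  then have B_pos: "emeasure (iid unif n) ?B \<noteq> 0" "emeasure (iid unif n) ?B \<noteq> \<infinity>"
    unfolding Q.emeasure_eq_measure prob_B using m by simp_all
  interpret V: prob_space "uniform_measure (iid unif n) ?B"
    using B_pos by (rule prob_space_uniform_measure)
  have "uniform_measure (iid unif n) ?B = iid ?N n"
  proof (rule PN.PiM_eqI)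
    fix A assume A: "\<And>i. i \<in> {1..n} \<Longrightarrow> A i \<in> sets ?N"
    then have A': "A i \<in> sets borel" if "i \<in> {1..n}" for i
      using that by simp
    have N_A: "N.prob (A i) = u.prob (A i \<inter> {..m}) / m" if "i \<in> {1..n}" for i
    proof -
      have "N.prob (A i) = u.prob {x. m * x \<in> A i}"
        using A'[OF that] by (subst measure_distr) (auto simp: vimage_def)
      then show ?thesis
        using unif_scale[OF m A'[OF that]] m by simp
    qed
    have "PiE {1..n} A \<in> sets (iid unif n)"
      using A' by (intro sets_PiM_I_finite) auto
    then have "V.prob (PiE {1..n} A) = measure (iid unif n) (?B \<inter> PiE {1..n} A) / m ^ n"
      using measure_uniform_measure[OF B_pos] by (simp only: prob_B)
    also have "?B \<inter> PiE {1..n} A = PiE {1..n} (\<lambda>i. A i \<inter> {..m})"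
      by (auto simp: PiE_Int)
    also have "measure (iid unif n) \<dots> = (\<Prod>i\<in>{1..n}. u.prob (A i \<inter> {..m}))"
      using A' by (intro measure_iid_box[OF real_distribution_unif]) auto
    also have "\<dots> = (\<Prod>i\<in>{1..n}. N.prob (A i) * m)"
      using N_A m by (intro prod.cong refl) simp
    also have "\<dots> / m ^ n = (\<Prod>i\<in>{1..n}. N.prob (A i))"
      using m by (simp add: prod.distrib)
    finally show "uniform_measure (iid unif n) ?B (PiE {1..n} A) = (\<Prod>i\<in>{1..n}. emeasure ?N (A i))"
      by (simp add: V.emeasure_eq_measure N.emeasure_eq_measure prod_ennreal)
  qed (simp_all add: sets_N)
  then have "measure (iid unif n) (?B \<inter> E) / m ^ n = measure (iid ?N n) E"
    using measure_uniform_measure[OF B_pos E] prob_B by simp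
  also have "iid ?N n = distr (iid unif n) (iid unif n) (compose {1..n} (\<lambda>x. m * x))"
  proof -
    have "distr unif unif (\<lambda>x. m * x) = ?N"
      by (rule distr_cong) simp_all
    then show ?thesis
      by (subst distr_PiM_finite_prob_space') (simp_all add: u.prob_space_axioms)
  qed
  also have "measure \<dots> E = measure (iid unif n) {y \<in> space (iid unif n). (\<lambda>i\<in>{1..n}. m * y i) \<in> E}"
  proof (subst measure_distr[OF _ E])
    show "compose {1..n} (\<lambda>x. m * x) \<in> iid unif n \<rightarrow>\<^sub>M iid unif n"
      unfolding compose_def
      by (intro measurable_restrict measurable_compose[OF measurable_component_singleton[where M = "\<lambda>_. unif"]]) auto
  qed (simp add: compose_def vimage_def Int_def conj_commute)
  finally show ?thesis
    using m by (simp add: field_simps Int_commute)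
qed

section \<open>One more observation makes the game harder\<close>

text \<open>The \<open>n + 1\<close> observations whose largest one is \<open>m\<close> at position \<open>k\<close> and whose other ones are \<open>m\<close> times those in \<open>y\<close>.\<close>

definition reinsert :: "nat \<Rightarrow> nat \<Rightarrow> real \<Rightarrow> (nat \<Rightarrow> real) \<Rightarrow> nat \<Rightarrow> real" where
  "reinsert n k m y = insert_at n k m (\<lambda>i\<in>{1..n}. m * y i)"

text \<open>The informed player sees \<open>y\<close>, reconstructs the longer sequence and follows \<open>\<sigma>\<close> there. Where \<open>\<sigma>\<close> would take the
  largest observation, at position \<open>k\<close>, the position in \<open>y\<close> just before it is taken (or the first one). This
  respects the flow of information, since a decision at time \<open>k\<close> is based on the \<open>k - 1\<close> earlier entries of \<open>y\<close>
  and the known \<open>m\<close>; which position is taken makes no difference, as the largest observation almost surely loses.\<close>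

definition reduced_rule :: "((nat \<Rightarrow> real) \<Rightarrow> nat) \<Rightarrow> nat \<Rightarrow> nat \<Rightarrow> real \<Rightarrow> (nat \<Rightarrow> real) \<Rightarrow> nat" where
  "reduced_rule \<sigma> n k m y =
    (let s = \<sigma> (reinsert n k m y) in if s < k then s else max 1 (s - 1))"

lemma reinsert_in_space: "reinsert n k m y \<in> space (iid unif (Suc n))"
  by (simp add: reinsert_def insert_at_def space_PiM)

lemma reinsert_at: "k \<in> {1..Suc n} \<Longrightarrow> reinsert n k m y k = m"
  by (simp add: reinsert_def insert_at_same)

lemma reinsert_other:
  assumes "k \<in> {1..Suc n}" "i \<in> {1..Suc n}" "i \<noteq> k"
  shows "reinsert n k m y i = m * y (if i < k then i else i - 1)"
proof (cases "i < k")
  case True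
  then have "i \<in> {1..n}" using assms by auto
  then show ?thesis using True assms(2) by (simp add: reinsert_def insert_at_def)
next
  case False
  then have "i - 1 \<in> {1..n}" using assms by auto
  then show ?thesis using False assms(2,3) by (simp add: reinsert_def insert_at_def)
qed

text \<open>Before time \<open>k - 1\<close> the two games run in step. From time \<open>k - 1\<close> on, the longer game is one observation ahead,
  since the value at position \<open>k\<close> is known in advance.\<close>

lemma reduced_rule_stopping:
  assumes \<sigma>: "\<sigma> \<in> stopping_rules (iid unif (Suc n)) coord (Suc n)"
    and k: "k \<in> {1..Suc n}" and "1 \<le> n"
  shows "reduced_rule \<sigma> n k m \<in> stopping_rules (iid unif n) coord n"
proof (rule stopping_rules_transport[OF \<sigma>, where \<phi> = "reinsert n k m" and g = "\<lambda>t. if t < k - 1 then t else Suc t"])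
  show "reinsert n k m \<in> space (iid unif n) \<rightarrow> space (iid unif (Suc n))"
    using reinsert_in_space by auto
  fix t i assume t: "1 \<le> t" "t < n" and i: "i \<in> {1..if t < k - 1 then t else Suc t}"
  let ?F = "natural_filtration (iid unif n) coord t"
  have scaled: "(\<lambda>y. m * y j) \<in> borel_measurable ?F" if "j \<in> {1..t}" for j
    using that by (intro borel_measurable_times borel_measurable_const measurable_natural_filtration)
  have "i \<in> {1..Suc n}" using t i by (auto split: if_splits)
  show "(\<lambda>y. coord i (reinsert n k m y)) \<in> borel_measurable ?F"
  proof (cases i k rule: linorder_cases)
    case less
    then have "i \<in> {1..t}" using i by (auto split: if_splits)
    then show ?thesis
      using scaled[of i] less reinsert_other[OF k \<open>i \<in> {1..Suc n}\<close>] by simp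
  next
    case equal
    then show ?thesis using reinsert_at[OF k] by simp
  next
    case greater
    then have "i - 1 \<in> {1..t}" using i k by (auto split: if_splits)
    then show ?thesis
      using scaled[of "i - 1"] greater reinsert_other[OF k \<open>i \<in> {1..Suc n}\<close>] by simp
  qed
next
  fix y :: "nat \<Rightarrow> real"
  have s: "\<sigma> (reinsert n k m y) \<in> {1..Suc n}"
    by (rule stopping_rules_range[OF \<sigma> reinsert_in_space])
  show "reduced_rule \<sigma> n k m y \<in> {1..n}"
    using s k \<open>1 \<le> n\<close> by (auto simp: reduced_rule_def Let_def)
  fix t :: nat assume "1 \<le> t" "t < n"
  then show "reduced_rule \<sigma> n k m y \<le> t \<longleftrightarrow> \<sigma> (reinsert n k m y) \<le> (if t < k - 1 then t else Suc t)"
    using s k by (auto simp: reduced_rule_def Let_def)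
qed

lemma reduced_rule_wins:
  assumes \<sigma>: "\<sigma> \<in> stopping_rules (iid unif (Suc n)) coord (Suc n)"
    and k: "k \<in> {1..Suc n}" and "1 \<le> n" and "0 < m"
    and y: "y \<in> space (iid unif n)" "\<forall>i\<in>{1..n}. 0 < y i \<and> y i < 1"
    and win: "reinsert n k m y \<in> win_event (iid unif (Suc n)) coord (Suc n) \<sigma>"
  shows "y \<in> win_event (iid unif n) coord n (reduced_rule \<sigma> n k m)"
proof -
  let ?x = "reinsert n k m y"
  let ?s = "\<sigma> ?x"
  have s: "?s \<in> {1..Suc n}"
    by (rule stopping_rules_range[OF \<sigma> reinsert_in_space])
  have "\<forall>i\<in>{1..Suc n}. ?x ?s \<le> ?x i"
    using win by (simp add: win_event_def)
  then have le_m: "?x ?s \<le> m" and le: "\<And>i. i \<in> {1..n} \<Longrightarrow> ?x ?s \<le> m * y i"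
    unfolding reinsert_def ball_insert_at[OF k, of "\<lambda>v. insert_at n k m (\<lambda>i\<in>{1..n}. m * y i) (\<sigma> (insert_at n k m (\<lambda>i\<in>{1..n}. m * y i))) \<le> v"]
    by auto
  have "?s \<noteq> k"
  proof
    assume "?s = k"
    then have "?x ?s = m"
      using reinsert_at[OF k] by simp
    then have "m \<le> m * y 1" using le[of 1] \<open>1 \<le> n\<close> by simp
    moreover have "y 1 < 1" using y(2) \<open>1 \<le> n\<close> by simp
    ultimately show False using \<open>0 < m\<close> by (simp add: mult_le_cancel_left1)
  qed
  moreover from this have "reduced_rule \<sigma> n k m y = (if ?s < k then ?s else ?s - 1)"
    using k by (auto simp: reduced_rule_def Let_def)
  ultimately have "?x ?s = m * y (reduced_rule \<sigma> n k m y)"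
    using reinsert_other[OF k s] by simp
  then have "y (reduced_rule \<sigma> n k m y) \<le> y i" if "i \<in> {1..n}" for i
    using le[OF that] \<open>0 < m\<close> by (simp add: mult_le_cancel_left)
  then show ?thesis using y(1) by (simp add: win_event_def)
qed

text \<open>The rule wins and the observation at \<open>k\<close> is a largest one. Several positions \<open>k\<close> may qualify, which only
  enlarges the sum of the probabilities of these events.\<close>

definition win_max_event :: "nat \<Rightarrow> ((nat \<Rightarrow> real) \<Rightarrow> nat) \<Rightarrow> nat \<Rightarrow> (nat \<Rightarrow> real) set" where
  "win_max_event n \<sigma> k = win_event (iid unif (Suc n)) coord (Suc n) \<sigma> \<inter>
     {\<omega> \<in> space (iid unif (Suc n)). \<forall>i\<in>{1..Suc n}. \<omega> i \<le> \<omega> k}"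

lemma win_max_event_measurable:
  assumes \<sigma>: "\<sigma> \<in> stopping_rules (iid unif (Suc n)) coord (Suc n)" and k: "k \<in> {1..Suc n}"
  shows "win_max_event n \<sigma> k \<in> sets (iid unif (Suc n))"
proof -
  have coord: "coord i \<in> borel_measurable (iid unif (Suc n))" if "i \<in> {1..Suc n}" for i
    using that by (intro measurable_coord_iid) auto
  have "{\<omega> \<in> space (iid unif (Suc n)). \<forall>i\<in>{1..Suc n}. \<omega> i \<le> \<omega> k} \<in> sets (iid unif (Suc n))"
    by (intro sets.sets_Collect_finite_All borel_measurable_le coord k) auto
  then show ?thesis
    unfolding win_max_event_def using win_event_measurable[OF \<sigma> coord] by (intro sets.Int) auto
qed

text \<open>The factor \<open>m ^ n\<close> is the probability that the other \<open>n\<close> observations do not exceed \<open>m\<close>. Given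
  this, \<open>\<sigma>\<close> wins at most when the reduced rule wins on these observations, rescaled to the unit interval.\<close>

lemma win_max_slice:
  assumes \<sigma>: "\<sigma> \<in> stopping_rules (iid unif (Suc n)) coord (Suc n)"
    and k: "k \<in> {1..Suc n}" and "1 \<le> n" and m: "0 < m" "m < 1"
  shows "measure (iid unif n) {y \<in> space (iid unif n). insert_at n k m y \<in> win_max_event n \<sigma> k} \<le>
    m ^ n * win_prob (iid unif n) coord n (reduced_rule \<sigma> n k m)"
proof -
  interpret Q: prob_space "iid unif n" by (rule iid_prob_space[OF real_distribution_unif])
  let ?W = "win_event (iid unif (Suc n)) coord (Suc n) \<sigma>"
  let ?E = "{y \<in> space (iid unif n). insert_at n k m y \<in> ?W}"
  let ?r = "reduced_rule \<sigma> n k m"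
  have r: "?r \<in> stopping_rules (iid unif n) coord n"
    by (rule reduced_rule_stopping[OF \<sigma> k \<open>1 \<le> n\<close>])
  have coord: "coord i \<in> borel_measurable (iid unif N)" if "i \<in> {1..N}" for i N
    using that by (intro measurable_coord_iid) auto
  have insert: "insert_at n k m \<in> iid unif n \<rightarrow>\<^sub>M iid unif (Suc n)"
    using measurable_compose[OF measurable_Pair1'[of m unif "iid unif n"] measurable_insert_at[OF real_distribution_unif k]]
    by simp
  have "?W \<in> sets (iid unif (Suc n))"
    by (rule win_event_measurable[OF \<sigma> coord])
  then have "insert_at n k m -` ?W \<inter> space (iid unif n) \<in> Q.events"
    by (rule measurable_sets[OF insert])
  moreover have "?E = insert_at n k m -` ?W \<inter> space (iid unif n)"
    by auto
  ultimately have E: "?E \<in> Q.events"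
    by (simp only:)
  have "{y \<in> space (iid unif n). insert_at n k m y \<in> win_max_event n \<sigma> k} = ?E \<inter> PiE {1..n} (\<lambda>_. {..m})"
  proof -
    have "insert_at n k m y \<in> space (iid unif (Suc n))" for y
      by (simp add: space_PiM insert_at_def)
    then show ?thesis
      using ball_insert_at[OF k, of "\<lambda>v. v \<le> m" m] insert_at_same[OF k, of m]
      by (auto simp: win_max_event_def space_PiM PiE_def Pi_iff)
  qed
  then have "measure (iid unif n) {y \<in> space (iid unif n). insert_at n k m y \<in> win_max_event n \<sigma> k} =
      m ^ n * Q.prob {y \<in> space (iid unif n). (\<lambda>i\<in>{1..n}. m * y i) \<in> ?E}"
    using iid_unif_scale[OF m(1) less_imp_le[OF m(2)] E] by simp
  moreover have "Q.prob {y \<in> space (iid unif n). (\<lambda>i\<in>{1..n}. m * y i) \<in> ?E} \<le> win_prob (iid unif n) coord n ?r"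
  proof -
    have "{y \<in> space (iid unif n). (\<lambda>i\<in>{1..n}. m * y i) \<in> ?E} = {y \<in> space (iid unif n). reinsert n k m y \<in> ?W}"
      by (auto simp: reinsert_def space_PiM)
    moreover have "AE y in iid unif n. y \<in> {y \<in> space (iid unif n). reinsert n k m y \<in> ?W} \<longrightarrow>
        y \<in> win_event (iid unif n) coord n ?r"
      using AE_iid_coordinates[OF real_distribution_unif AE_unif, of n]
      by eventually_elim (use reduced_rule_wins[OF \<sigma> k \<open>1 \<le> n\<close> m(1)] in blast)
    then have "Q.prob {y \<in> space (iid unif n). reinsert n k m y \<in> ?W} \<le> Q.prob (win_event (iid unif n) coord n ?r)"
      by (rule Q.finite_measure_mono_AE) (rule win_event_measurable[OF r coord])
    moreover have "win_prob (iid unif n) coord n ?r = Q.prob (win_event (iid unif n) coord n ?r)"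
      by (rule win_prob_eq) (rule stopping_rules_range[OF r])
    ultimately show ?thesis by (simp only:)
  qed
  then have "m ^ n * Q.prob {y \<in> space (iid unif n). (\<lambda>i\<in>{1..n}. m * y i) \<in> ?E} \<le> m ^ n * win_prob (iid unif n) coord n ?r"
    using m by (intro mult_left_mono) auto
  ultimately show ?thesis by (simp only:)
qed

lemma integrable_unif_power: "integrable unif (\<lambda>x. x ^ k :: real)"
proof -
  interpret real_distribution unif by (rule real_distribution_unif)
  show ?thesis
  proof (rule integrable_const_bound)
    show "AE x in unif. norm (x ^ k) \<le> 1"
      using AE_unif by eventually_elim (auto simp: power_le_one)
  qed simp
qed

text \<open>The informed player does no better than the value of the shorter game, whatever \<open>m\<close> is, and the weights
  \<open>m ^ n\<close> integrate to \<open>1 / (n + 1)\<close>.\<close>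

lemma win_max_prob_le:
  assumes \<sigma>: "\<sigma> \<in> stopping_rules (iid unif (Suc n)) coord (Suc n)"
    and k: "k \<in> {1..Suc n}" and "1 \<le> n"
  shows "measure (iid unif (Suc n)) (win_max_event n \<sigma> k) \<le> full_info_value n / real (Suc n)"
proof -
  note slice = measure_iid_Suc[OF real_distribution_unif k win_max_event_measurable[OF \<sigma> k]]
  have "measure (iid unif (Suc n)) (win_max_event n \<sigma> k) \<le> (LINT m|unif. m ^ n * full_info_value n)"
    unfolding slice(2)
  proof (rule integral_mono_AE[OF slice(1)])
    show "integrable unif (\<lambda>m. m ^ n * full_info_value n)"
      using integrable_unif_power by simp
    show "AE m in unif. measure (iid unif n) {y \<in> space (iid unif n). insert_at n k m y \<in> win_max_event n \<sigma> k} \<le>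
        m ^ n * full_info_value n"
      using AE_unif
    proof eventually_elim
      case (elim m)
      have "win_prob (iid unif n) coord n (reduced_rule \<sigma> n k m) \<le> full_info_value n"
        unfolding full_info_value_def iid_value_def
        by (rule win_prob_le_value[OF iid_prob_space[OF real_distribution_unif] reduced_rule_stopping[OF \<sigma> k \<open>1 \<le> n\<close>]])
      then have "m ^ n * win_prob (iid unif n) coord n (reduced_rule \<sigma> n k m) \<le> m ^ n * full_info_value n"
        using elim by (intro mult_left_mono) auto
      then show ?case
        using win_max_slice[OF \<sigma> k \<open>1 \<le> n\<close>, of m] elim by linarith
    qed
  qed
  then show ?thesis
    by (simp add: integral_unif_power)
qed

text \<open>With the largest observation at the last position, \<open>\<sigma>\<close> takes its first decision from the absolute value of the
  first observation, by membership in some set \<open>S\<close>, and the reduced rule takes it by membership in \<open>S\<close> scaled by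
  \<open>1 / m\<close>. First observations in the interval \<open>A\<close> are relatively small for \<open>m \<ge> 1/2\<close> and relatively large for \<open>m\<close>
  slightly above \<open>A\<close>. So the part of \<open>A\<close> outside \<open>S\<close> costs for the former \<open>m\<close>, the part inside \<open>S\<close> costs for the
  latter, and the two parts together have the measure of \<open>A\<close>.\<close>

lemma win_max_prob_less:
  assumes "2 \<le> n"
  obtains c where "0 < c" and "\<And>\<sigma>. \<sigma> \<in> stopping_rules (iid unif (Suc n)) coord (Suc n) \<Longrightarrow>
    measure (iid unif (Suc n)) (win_max_event n \<sigma> (Suc n)) \<le> full_info_value n / real (Suc n) - c"
proof -
  interpret u: real_distribution unif by (rule real_distribution_unif)
  define a where "a = 1 / (4 * real n)"
  have a: "0 < a" "a \<le> 1 / 8"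
    using \<open>2 \<le> n\<close> by (auto simp: a_def field_simps)
  \<comment> \<open>\<open>x / m\<close> is below \<open>a\<close> for \<open>x \<in> A\<close> and \<open>m \<ge> 1/2\<close>, and it lies in \<open>{3/4..1}\<close> for \<open>x \<in> A\<close> and \<open>m \<in> {a/2..<7a/12}\<close>\<close>
  define A where "A = {7 * a / 16..<a / 2}"
  have A: "A \<in> sets borel" "measure unif A = a / 16"
    using a measure_unif_atLeastLessThan[of "7 * a / 16" "a / 2"] by (auto simp: A_def)
  define g where "g = (1 / 2 :: real) ^ n * (a / 2) ^ n"
  have "0 < g" using a by (simp add: g_def)
  define V where "V = full_info_value n"
  have "1 \<le> n" using \<open>2 \<le> n\<close> by simp
  have k: "Suc n \<in> {1..Suc n}" by simp
  have "measure (iid unif (Suc n)) (win_max_event n \<sigma> (Suc n)) \<le> V / real (Suc n) - g * (a / 12 * (a / 16))"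
    if \<sigma>: "\<sigma> \<in> stopping_rules (iid unif (Suc n)) coord (Suc n)" for \<sigma>
  proof -
    obtain S where S: "S \<in> sets borel" and S_iff: "\<And>\<omega>. \<omega> \<in> space (iid unif (Suc n)) \<Longrightarrow> \<sigma> \<omega> = 1 \<longleftrightarrow> \<omega> 1 \<in> S"
      using first_decision_set[OF \<sigma>] by blast
    define p q where "p = u.prob (A - S)" and "q = u.prob (A \<inter> S)"
    have pq: "0 \<le> p" "0 \<le> q" "p + q = a / 16"
    proof -
      have "p + q = u.prob ((A - S) \<union> (A \<inter> S))"
        unfolding p_def q_def using A S by (intro u.finite_measure_Union[symmetric]) auto
      also have "(A - S) \<union> (A \<inter> S) = A" by blast
      finally show "p + q = a / 16" by (simp add: A)
    qed (simp_all add: p_def q_def)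
    \<comment> \<open>\<open>g * d m\<close> bounds the regret for given \<open>m\<close> from below, weighted with \<open>m ^ n\<close>\<close>
    define d where "d m = indicator {1/2..<1} m * p + indicator {a/2..<7 * a / 12} m * q" for m :: real
    note slice = measure_iid_Suc[OF real_distribution_unif k win_max_event_measurable[OF \<sigma> k]]
    have main: "measure (iid unif n) {y \<in> space (iid unif n). insert_at n (Suc n) m y \<in> win_max_event n \<sigma> (Suc n)} \<le>
        m ^ n * V - g * d m" if m: "0 < m" "m < 1" for m
    proof -
      let ?r = "reduced_rule \<sigma> n (Suc n) m"
      let ?S = "{x. m * x \<in> S}"
      have S': "?S \<in> sets borel" using S by measurable
      have r: "?r \<in> stopping_rules (iid unif n) coord n"
        by (rule reduced_rule_stopping[OF \<sigma> k \<open>1 \<le> n\<close>])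
      have r_iff: "?r y = 1 \<longleftrightarrow> y 1 \<in> ?S" for y
      proof -
        have "reinsert n (Suc n) m y 1 = m * y 1"
          using \<open>1 \<le> n\<close> by (simp add: reinsert_def insert_at_def)
        moreover have "?r y = 1 \<longleftrightarrow> \<sigma> (reinsert n (Suc n) m y) = 1"
          using stopping_rules_range[OF \<sigma> reinsert_in_space, of "Suc n" m y] \<open>2 \<le> n\<close>
          by (auto simp: reduced_rule_def Let_def max_def)
        ultimately show ?thesis
          using S_iff[OF reinsert_in_space, of "Suc n" m y] by simp
      qed
      let ?loss = "u.prob ({0..<a} - ?S) + u.prob (?S \<inter> {3/4..1})"
      have loss: "win_prob (iid unif n) coord n ?r + (1 / 2) ^ n * ?loss \<le> V"
        unfolding V_def a_def by (rule first_decision_loss[OF \<open>2 \<le> n\<close> r S' r_iff])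
      have dilate: "u.prob B \<le> u.prob {x. m * x \<in> B}" if "B \<in> sets borel" "B \<subseteq> {..m}" for B
      proof -
        have "u.prob B = m * u.prob {x. m * x \<in> B}"
          using unif_scale[OF m(1) less_imp_le[OF m(2)] that(1)] that(2) by (simp add: Int_absorb2)
        also have "\<dots> \<le> u.prob {x. m * x \<in> B}"
          using m by (intro mult_left_le_one_le) auto
        finally show ?thesis .
      qed
      have "(a / 2) ^ n * d m \<le> m ^ n * ?loss"
      proof -
        consider "m \<in> {1/2..<1}" | "m \<in> {a/2..<7 * a / 12}" | "m \<notin> {1/2..<1}" "m \<notin> {a/2..<7 * a / 12}" by blast
        then show ?thesis
        proof cases
          case 1
          have "p \<le> u.prob {x. m * x \<in> A - S}"
            unfolding p_def using A S 1 a by (intro dilate) (auto simp: A_def)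
          also have "\<dots> \<le> u.prob ({0..<a} - ?S)"
          proof (rule u.finite_measure_mono)
            show "{x. m * x \<in> A - S} \<subseteq> {0..<a} - ?S"
            proof
              fix x assume x: "x \<in> {x. m * x \<in> A - S}"
              then have "0 < m * x" "m * x < a / 2" using a by (auto simp: A_def)
              moreover have "1 / 2 * a \<le> m * a" using 1 a by (intro mult_right_mono) auto
              ultimately have "m * x < m * a" by linarith
              then have "x < a" using mult_less_cancel_left_pos[OF m(1)] by blast
              moreover have "0 < x" using \<open>0 < m * x\<close> zero_less_mult_pos m(1) by blast
              ultimately show "x \<in> {0..<a} - ?S" using x by simp
            qed
          qed (use S' in auto)
          finally have "p \<le> ?loss" by (simp add: add_increasing2)
          moreover have "d m = p" using 1 a by (auto simp: d_def)
          moreover have "(a / 2) ^ n \<le> m ^ n" using 1 a by (intro power_mono) auto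
          ultimately show ?thesis using pq m by (intro mult_mono) auto
        next
          case 2
          have "q \<le> u.prob {x. m * x \<in> A \<inter> S}"
            unfolding q_def using A S 2 a by (intro dilate) (auto simp: A_def)
          also have "\<dots> \<le> u.prob (?S \<inter> {3/4..1})"
          proof (rule u.finite_measure_mono)
            show "{x. m * x \<in> A \<inter> S} \<subseteq> ?S \<inter> {3/4..1}"
            proof
              fix x assume x: "x \<in> {x. m * x \<in> A \<inter> S}"
              then have "7 * a / 16 \<le> m * x" "m * x < a / 2" by (auto simp: A_def)
              moreover have "a / 2 \<le> m" "m < 7 * a / 12" using 2 by auto
              ultimately have "m * (3 / 4) \<le> m * x" "m * x \<le> m * 1" by linarith+
              then have "3 / 4 \<le> x" "x \<le> 1" using mult_le_cancel_left_pos[OF m(1)] by blast+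
              then show "x \<in> ?S \<inter> {3/4..1}" using x by simp
            qed
          qed (use S' in auto)
          finally have "q \<le> ?loss" by (simp add: add_increasing)
          moreover have "d m = q" using 2 a by (auto simp: d_def)
          moreover have "(a / 2) ^ n \<le> m ^ n" using 2 a by (intro power_mono) auto
          ultimately show ?thesis using pq m by (intro mult_mono) auto
        next
          case 3
          then have "d m = 0" by (simp add: d_def)
          then show ?thesis using m by simp
        qed
      qed
      then have "g * d m \<le> (1 / 2) ^ n * (m ^ n * ?loss)"
        unfolding g_def mult.assoc by (rule mult_left_mono) simp
      moreover have "m ^ n * (win_prob (iid unif n) coord n ?r + (1 / 2) ^ n * ?loss) \<le> m ^ n * V"
        using loss m by (intro mult_left_mono) auto
      ultimately show ?thesis
        using win_max_slice[OF \<sigma> k \<open>1 \<le> n\<close> m] by (simp add: algebra_simps)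
    qed
    have int: "integrable unif (indicator {1/2..<1} :: real \<Rightarrow> real)" "integrable unif (indicator {a/2..<7 * a / 12} :: real \<Rightarrow> real)"
      by (intro integrable_real_indicator; simp add: u.emeasure_eq_measure)+
    have int_d: "integrable unif d"
      unfolding d_def using int by (intro Bochner_Integration.integrable_add integrable_mult_left) auto
    have "(LINT m|unif. d m) = u.prob {1/2..<1} * p + u.prob {a/2..<7 * a / 12} * q"
      unfolding d_def using int by simp
    also have "\<dots> = 1 / 2 * p + a / 12 * q"
      using measure_unif_atLeastLessThan[of "1/2" 1] measure_unif_atLeastLessThan[of "a/2" "7 * a / 12"] a
      by (simp add: field_simps)
    finally have "(LINT m|unif. d m) = 1 / 2 * p + a / 12 * q" .
    moreover have "a / 12 * p \<le> 1 / 2 * p"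
      using a pq by (intro mult_right_mono) auto
    ultimately have d_ge: "a / 12 * (p + q) \<le> (LINT m|unif. d m)"
      by (simp add: algebra_simps)
    have "measure (iid unif (Suc n)) (win_max_event n \<sigma> (Suc n)) \<le> (LINT m|unif. m ^ n * V - g * d m)"
      unfolding slice(2)
    proof (rule integral_mono_AE[OF slice(1)])
      show "integrable unif (\<lambda>m. m ^ n * V - g * d m)"
        using integrable_unif_power int_d by (intro Bochner_Integration.integrable_diff) auto
      show "AE m in unif. measure (iid unif n) {y \<in> space (iid unif n). insert_at n (Suc n) m y \<in> win_max_event n \<sigma> (Suc n)} \<le>
          m ^ n * V - g * d m"
        using AE_unif by eventually_elim (use main in blast)
    qed
    also have "\<dots> = V / real (Suc n) - g * (LINT m|unif. d m)"
      using integrable_unif_power int_d by (simp add: integral_unif_power)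
    also have "\<dots> \<le> V / real (Suc n) - g * (a / 12 * (a / 16))"
      using d_ge \<open>0 < g\<close> pq(3) by (simp add: mult_left_mono)
    finally show ?thesis .
  qed
  moreover have "0 < g * (a / 12 * (a / 16))"
    using \<open>0 < g\<close> a by simp
  ultimately show thesis
    using that unfolding V_def by blast
qed

lemma win_prob_le_sum_win_max:
  assumes \<sigma>: "\<sigma> \<in> stopping_rules (iid unif (Suc n)) coord (Suc n)"
  shows "win_prob (iid unif (Suc n)) coord (Suc n) \<sigma> \<le>
    (\<Sum>k\<in>{1..Suc n}. measure (iid unif (Suc n)) (win_max_event n \<sigma> k))"
proof -
  interpret Q: prob_space "iid unif (Suc n)" by (rule iid_prob_space[OF real_distribution_unif])
  let ?W = "win_event (iid unif (Suc n)) coord (Suc n) \<sigma>"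
  have sets: "win_max_event n \<sigma> ` {1..Suc n} \<subseteq> Q.events"
    using win_max_event_measurable[OF \<sigma>] by auto
  have "?W \<subseteq> (\<Union>k\<in>{1..Suc n}. win_max_event n \<sigma> k)"
  proof
    fix \<omega> assume \<omega>: "\<omega> \<in> ?W"
    have "Max (\<omega> ` {1..Suc n}) \<in> \<omega> ` {1..Suc n}"
      by (rule Max_in) auto
    then obtain k where k: "k \<in> {1..Suc n}" "Max (\<omega> ` {1..Suc n}) = \<omega> k"
      by (rule imageE)
    have "\<forall>i\<in>{1..Suc n}. \<omega> i \<le> \<omega> k"
      unfolding k(2)[symmetric] by (intro ballI Max_ge) auto
    then have "\<omega> \<in> win_max_event n \<sigma> k"
      using \<omega> by (simp add: win_max_event_def win_event_def)
    with k(1) show "\<omega> \<in> (\<Union>k\<in>{1..Suc n}. win_max_event n \<sigma> k)" by blast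
  qed
  then have "Q.prob ?W \<le> Q.prob (\<Union>k\<in>{1..Suc n}. win_max_event n \<sigma> k)"
    using sets by (intro Q.finite_measure_mono sets.finite_UN) auto
  also have "\<dots> \<le> (\<Sum>k\<in>{1..Suc n}. Q.prob (win_max_event n \<sigma> k))"
    using sets by (intro Q.finite_measure_subadditive_finite) auto
  finally show ?thesis
    using stopping_rules_range[OF \<sigma>] by (simp only: win_prob_eq)
qed

lemma full_info_value_Suc_le:
  assumes "1 \<le> n"
  shows "full_info_value (Suc n) \<le> full_info_value n"
  unfolding full_info_value_def[of "Suc n"] iid_value_def
proof (rule value_leI)
  fix \<sigma> assume \<sigma>: "\<sigma> \<in> stopping_rules (iid unif (Suc n)) coord (Suc n)"
  have "(\<Sum>k\<in>{1..Suc n}. measure (iid unif (Suc n)) (win_max_event n \<sigma> k)) \<le> (\<Sum>k\<in>{1..Suc n}. full_info_value n / real (Suc n))"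
    using win_max_prob_le[OF \<sigma> _ assms] by (rule sum_mono)
  then show "win_prob (iid unif (Suc n)) coord (Suc n) \<sigma> \<le> full_info_value n"
    using win_prob_le_sum_win_max[OF \<sigma>] by simp
qed simp

lemma full_info_value_Suc_less:
  assumes "2 \<le> n"
  shows "full_info_value (Suc n) < full_info_value n"
proof -
  obtain c where "0 < c" and c: "\<And>\<sigma>. \<sigma> \<in> stopping_rules (iid unif (Suc n)) coord (Suc n) \<Longrightarrow>
      measure (iid unif (Suc n)) (win_max_event n \<sigma> (Suc n)) \<le> full_info_value n / real (Suc n) - c"
    using win_max_prob_less[OF assms] by blast
  have "full_info_value (Suc n) \<le> full_info_value n - c"
    unfolding full_info_value_def[of "Suc n"] iid_value_def
  proof (rule value_leI)
    fix \<sigma> assume \<sigma>: "\<sigma> \<in> stopping_rules (iid unif (Suc n)) coord (Suc n)"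
    let ?P = "\<lambda>k. measure (iid unif (Suc n)) (win_max_event n \<sigma> k)"
    define x where "x = full_info_value n / real (Suc n)"
    have "real (Suc n) * x = full_info_value n"
      by (simp add: x_def)
    then have x: "(\<Sum>k\<in>{1..n}. x) + x = full_info_value n"
      by (simp add: algebra_simps)
    have "(\<Sum>k\<in>{1..n}. ?P k) \<le> (\<Sum>k\<in>{1..n}. x)"
      using win_max_prob_le[OF \<sigma>] assms unfolding x_def by (intro sum_mono) auto
    moreover have "(\<Sum>k\<in>{1..Suc n}. ?P k) = (\<Sum>k\<in>{1..n}. ?P k) + ?P (Suc n)"
      by simp
    ultimately show "win_prob (iid unif (Suc n)) coord (Suc n) \<sigma> \<le> full_info_value n - c"
      using win_prob_le_sum_win_max[OF \<sigma>] c[OF \<sigma>] x unfolding x_def by linarith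
  qed simp
  then show ?thesis using \<open>0 < c\<close> by simp
qed

text \<open>Monotonicity alone gives the limit; strictness one step later keeps every value above it. The step from 1 to 2
  is covered by the weak inequality.\<close>

lemma full_info_value_limit:
  shows "full_info_value \<longlonglongrightarrow> full_info_limit"
    and "1 \<le> n \<Longrightarrow> full_info_limit < full_info_value n"
proof -
  have decr: "decseq (\<lambda>n. full_info_value (Suc n))"
    by (rule decseq_SucI) (rule full_info_value_Suc_le, simp)
  have nonneg: "0 \<le> full_info_value (Suc n)" for n
  proof -
    have "0 \<le> win_prob (iid unif (Suc n)) coord (Suc n) (\<lambda>_. 1)"
      by (simp add: win_prob_def)
    also have "\<dots> \<le> full_info_value (Suc n)"
      unfolding full_info_value_def iid_value_def
      by (rule win_prob_le_value[OF iid_prob_space[OF real_distribution_unif] constant_rule]) simp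
    finally show ?thesis .
  qed
  obtain L where L: "(\<lambda>n. full_info_value (Suc n)) \<longlonglongrightarrow> L" and ge: "\<forall>n. L \<le> full_info_value (Suc n)"
    by (rule decseq_convergent[OF decr allI[OF nonneg]])
  have "full_info_value \<longlonglongrightarrow> L"
    using L by (simp add: filterlim_sequentially_Suc)
  then have lim: "full_info_limit = L"
    unfolding full_info_limit_def by (rule limI)
  show "full_info_value \<longlonglongrightarrow> full_info_limit"
    using \<open>full_info_value \<longlonglongrightarrow> L\<close> by (simp only: lim)
  assume "1 \<le> n"
  have "full_info_limit \<le> full_info_value (Suc (Suc n))"
    using ge by (simp only: lim)
  also have "\<dots> < full_info_value (Suc n)"
    using \<open>1 \<le> n\<close> by (intro full_info_value_Suc_less) simp
  also have "\<dots> \<le> full_info_value n"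
    using \<open>1 \<le> n\<close> by (rule full_info_value_Suc_le)
  finally show "full_info_limit < full_info_value n" .
qed

theorem proposition2:
  fixes M :: "'a measure" and X :: "nat \<Rightarrow> 'a \<Rightarrow> real" and F :: "real \<Rightarrow> real" and n :: nat
  assumes "prob_space M"
    and "n \<ge> 1"
    and "prob_space.indep_vars M (\<lambda>_. borel) X {1..n}"
    and "\<And>i. i \<in> {1..n} \<Longrightarrow> cdf (distr M borel (X i)) = F"
  shows "full_info_value n \<le> best_choice_value M X n \<and>
         best_choice_value M X n \<le> full_info_value n + tie_prob M X n \<and>
         tie_prob M X n = 1 - real n * (LINT x|interval_measure F. (1 - F x) ^ (n - 1)) \<and>
         best_choice_value M X n > full_info_limit \<and>
         (\<forall>c > full_info_limit. \<exists>m\<ge>1. \<exists>\<nu>. real_distribution \<nu> \<and> iid_value \<nu> m < c)"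
proof -
  interpret prob_space M by fact
  have law: "real_distribution (distr M borel (X i))" if "i \<in> {1..n}" for i
    using assms(3) that by (intro real_distribution_distr) (auto simp: indep_vars_def)
  define \<nu> where "\<nu> = distr M borel (X 1)"
  have \<nu>: "real_distribution \<nu>"
    unfolding \<nu>_def using \<open>n \<ge> 1\<close> by (intro law) simp
  interpret \<nu>: real_distribution \<nu> by fact
  have F: "cdf \<nu> = F"
    unfolding \<nu>_def using \<open>n \<ge> 1\<close> by (intro assms(4)) simp
  have same: "distr M borel (X i) = \<nu>" if "i \<in> {1..n}" for i
    using law[OF that] \<nu> assms(4)[OF that] F by (intro cdf_unique) simp_all
  have "interval_measure F = \<nu>"
  proof (rule cdf_unique[OF _ \<nu>])
    show "real_distribution (interval_measure F)"
      unfolding F[symmetric]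
      by (intro real_distribution_interval_measure \<nu>.cdf_nondecreasing \<nu>.cdf_is_right_cont
          \<nu>.cdf_lim_at_bot \<nu>.cdf_lim_at_top_prob)
    show "cdf (interval_measure F) = cdf \<nu>"
      unfolding F[symmetric]
      by (intro cdf_interval_measure \<nu>.cdf_nondecreasing \<nu>.cdf_is_right_cont \<nu>.cdf_lim_at_bot)
  qed
  have game_value: "best_choice_value M X n = iid_value \<nu> n"
    by (rule indep_vars_reduction(1)[OF assms(1,2,3)]) (rule same)
  have game_tie: "tie_prob M X n = tie_prob (iid \<nu> n) coord n"
    by (rule indep_vars_reduction(2)[OF assms(1,2,3)]) (rule same)
  have lower: "full_info_value n \<le> best_choice_value M X n"
    unfolding game_value by (rule full_info_value_le_iid_value[OF \<nu> assms(2)])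
  moreover have "best_choice_value M X n \<le> full_info_value n + tie_prob M X n"
    unfolding game_value game_tie by (rule iid_value_le_full_info_value_plus_tie[OF \<nu> assms(2)])
  moreover have "tie_prob M X n = 1 - real n * (LINT x|interval_measure F. (1 - F x) ^ (n - 1))"
    unfolding game_tie \<open>interval_measure F = \<nu>\<close> using tie_prob_iid[OF \<nu> assms(2)] by (simp only: F)
  moreover have "full_info_limit < best_choice_value M X n"
    using full_info_value_limit(2)[OF assms(2)] lower by simp
  moreover have "\<exists>m\<ge>1. \<exists>\<nu>. real_distribution \<nu> \<and> iid_value \<nu> m < c" if "full_info_limit < c" for c
  proof -
    have "eventually (\<lambda>m. full_info_value m < c) sequentially"
      using full_info_value_limit(1) that by (rule order_tendstoD)
    then have "eventually (\<lambda>m. 1 \<le> m \<and> full_info_value m < c) sequentially"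
      by (rule eventually_conj[OF eventually_ge_at_top])
    then obtain m where "1 \<le> m" "full_info_value m < c"
      by (auto dest!: eventually_happens)
    then show ?thesis
      using real_distribution_unif unfolding full_info_value_def by blast
  qed
  ultimately show ?thesis by blast
qed

end
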